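(* Let $P$ be the poset associated to a skew shape $\lambda/\mu$, let $A\subseteq P$ be a subset (with the induced order) containing the minimal and maximal elements of $P$, and let $\ell\colon A\to\mathbb{Z}$. Then the marked order polytope $\mathcal{O}_{P,A}(\ell)$ is Ehrhart positive.
   Context: For partitions $\lambda=(\lambda_1\ge\lambda_2\ge\cdots)$ and $\mu=(\mu_1\ge\mu_2\ge\cdots)$ with $\mu_i\le\lambda_i$ for all $i$, the poset $P$ associated to the skew shape $\lambda/\mu$ has as elements the cells $\{(i,j)\colon \mu_i+1\le j\le\lambda_i\}$, with covering relations $(i+1,j)\prec_P(i,j)$ and $(i,j+1)\prec_P(i,j)$ (whenever both cells exist). For $A\subseteq P$ and $\ell\colon A\to\mathbb{Z}$, the marked order polytope is $\mathcal{O}_{P,A}(\ell)=\{\hat\ell\colon P\to\mathbb{R}\text{ order preserving with }\hat\ell(a)=\ell(a)\ \forall a\in A\}\subset\mathbb{R}^P$, where order preserving means $\hat\ell(p)\le\hat\ell(q)$ whenever $p\prec_P q$; it is a (possibly empty) lattice polytope. A lattice polytope $Q\subset\mathbb{R}^d$ is Ehrhart positive if its Ehrhart polynomial $E_Q(n)=|nQ\cap\mathbb{Z}^d|$ ($n\ge0$) has only nonnegative coefficients. *)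

theory Defs
  imports Complex_Main "HOL-Library.FuncSet" "HOL-Computational_Algebra.Polynomial"
begin

text \<open>A partition \<open>\<lambda>\<^sub>1 \<ge> \<lambda>\<^sub>2 \<ge> \<dots>\<close> is a function on \<^typ>\<open>nat\<close> read at the arguments
  \<open>1, 2, \<dots>\<close>; the value at \<open>0\<close> is irrelevant.\<close>

definition is_partition :: "(nat \<Rightarrow> nat) \<Rightarrow> bool" where
  "is_partition lam \<longleftrightarrow> (\<forall>i\<ge>1. lam (i + 1) \<le> lam i) \<and> finite {i. i \<ge> 1 \<and> lam i \<noteq> 0}"

definition skew_shape :: "(nat \<Rightarrow> nat) \<Rightarrow> (nat \<Rightarrow> nat) \<Rightarrow> bool" where
  "skew_shape lam mu \<longleftrightarrow> is_partition lam \<and> is_partition mu \<and> (\<forall>i\<ge>1. mu i \<le> lam i)"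

definition skew_cells :: "(nat \<Rightarrow> nat) \<Rightarrow> (nat \<Rightarrow> nat) \<Rightarrow> (nat \<times> nat) set" where
  "skew_cells lam mu = {(i, j). 1 \<le> i \<and> mu i + 1 \<le> j \<and> j \<le> lam i}"

text \<open>A pair \<open>(p, q)\<close> in the following relations means that \<open>p\<close> lies below \<open>q\<close>.\<close>

definition skew_covers :: "(nat \<Rightarrow> nat) \<Rightarrow> (nat \<Rightarrow> nat) \<Rightarrow> ((nat \<times> nat) \<times> (nat \<times> nat)) set" where
  "skew_covers lam mu =
     ({((i + 1, j), (i, j)) | i j. True} \<union> {((i, j + 1), (i, j)) | i j. True})
       \<inter> skew_cells lam mu \<times> skew_cells lam mu"

definition skew_less :: "(nat \<Rightarrow> nat) \<Rightarrow> (nat \<Rightarrow> nat) \<Rightarrow> ((nat \<times> nat) \<times> (nat \<times> nat)) set" where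
  "skew_less lam mu = (skew_covers lam mu)\<^sup>+"

definition minimal_elements :: "'a set \<Rightarrow> ('a \<times> 'a) set \<Rightarrow> 'a set" where
  "minimal_elements P r = {p \<in> P. \<not> (\<exists>q\<in>P. (q, p) \<in> r)}"

definition maximal_elements :: "'a set \<Rightarrow> ('a \<times> 'a) set \<Rightarrow> 'a set" where
  "maximal_elements P r = {p \<in> P. \<not> (\<exists>q\<in>P. (p, q) \<in> r)}"

text \<open>The space \<open>\<real>\<^sup>I\<close> is \<^term>\<open>I \<rightarrow>\<^sub>E (UNIV :: real set)\<close>, that is, functions that are
  \<^const>\<open>undefined\<close> outside \<open>I\<close>; the lattice \<open>\<int>\<^sup>I\<close> is \<^term>\<open>I \<rightarrow>\<^sub>E (\<int> :: real set)\<close>.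
  The vector operations are therefore pointwise operations restricted to \<open>I\<close>.\<close>

definition marked_order_polytope ::
    "'a set \<Rightarrow> ('a \<times> 'a) set \<Rightarrow> 'a set \<Rightarrow> ('a \<Rightarrow> int) \<Rightarrow> ('a \<Rightarrow> real) set" where
  "marked_order_polytope P r A l =
     {f \<in> P \<rightarrow>\<^sub>E UNIV.
        (\<forall>p\<in>P. \<forall>q\<in>P. (p, q) \<in> r \<longrightarrow> f p \<le> f q) \<and> (\<forall>a\<in>A. f a = of_int (l a))}"

definition finite_convex_hull :: "'a set \<Rightarrow> ('a \<Rightarrow> real) set \<Rightarrow> ('a \<Rightarrow> real) set" where
  "finite_convex_hull I V =
     {(\<lambda>i\<in>I. \<Sum>v\<in>V. c v * v i) | c. (\<forall>v\<in>V. 0 \<le> c v) \<and> (\<Sum>v\<in>V. c v) = (1::real)}"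

text \<open>The empty set is a lattice polytope, with \<open>V = {}\<close>.\<close>

definition lattice_polytope :: "'a set \<Rightarrow> ('a \<Rightarrow> real) set \<Rightarrow> bool" where
  "lattice_polytope I Q \<longleftrightarrow>
     (\<exists>V. finite V \<and> V \<subseteq> (I \<rightarrow>\<^sub>E \<int>) \<and> Q = finite_convex_hull I V)"

definition dilate :: "'a set \<Rightarrow> nat \<Rightarrow> ('a \<Rightarrow> real) set \<Rightarrow> ('a \<Rightarrow> real) set" where
  "dilate I n Q = (\<lambda>f. \<lambda>i\<in>I. real n * f i) ` Q"

text \<open>Finiteness is stated because \<^const>\<open>card\<close> of an infinite set is \<open>0\<close>.\<close>

definition is_ehrhart_polynomial :: "'a set \<Rightarrow> ('a \<Rightarrow> real) set \<Rightarrow> real poly \<Rightarrow> bool" where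
  "is_ehrhart_polynomial I Q E \<longleftrightarrow>
     (\<forall>n. finite (dilate I n Q \<inter> (I \<rightarrow>\<^sub>E \<int>)) \<and>
          poly E (real n) = real (card (dilate I n Q \<inter> (I \<rightarrow>\<^sub>E \<int>))))"

text \<open>A real polynomial is determined by its values at the natural numbers, so there is
  at most one \<open>E\<close> as below.\<close>

definition ehrhart_positive :: "'a set \<Rightarrow> ('a \<Rightarrow> real) set \<Rightarrow> bool" where
  "ehrhart_positive I Q \<longleftrightarrow>
     lattice_polytope I Q \<and> (\<exists>E. is_ehrhart_polynomial I Q E \<and> (\<forall>k. 0 \<le> coeff E k))"

end

theory Submission
  imports Defs "Jordan_Normal_Form.Determinant"
begin

text \<open>Cutting the lattice points of the \<open>n\<close>-th dilation at the level \<open>n\<close> (after a shift that makes the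
  marking nonnegative), and repeating this, writes the Ehrhart polynomial as a sum of products of
  order polynomials of convex subsets of the skew shape. It therefore suffices that these order
  polynomials have nonnegative coefficients. The derivative of an order polynomial is a combination
  of order polynomials of smaller convex subsets, weighted by linear coefficients of order
  polynomials, so it is enough that linear coefficients are nonnegative. Kreweras' determinant gives
  the linear coefficient: it is \<open>(r - 1)! (c - 1)! / (r + c - 1)!\<close> for a connected skew shape with
  \<open>r\<close> rows and \<open>c\<close> columns, and \<open>0\<close> for a disconnected one.\<close>

section \<open>Order polynomials\<close>

text \<open>Nonnegativity of all coefficients is hard to read off an alternating determinant, but
  the linear coefficient is accessible: at \<open>x = 0\<close> the first row of the matrix
  vanishes, and for a connected shape the other rows are lower triangular once the last column is
  removed. Coefficient \<open>k + 1\<close> of a polynomial is \<open>1 / (k + 1)\<close> times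
  coefficient \<open>k\<close> of its derivative, so control of linear coefficients is enough for an
  induction on the size of the poset. The induction needs a class of posets that is closed under
  passing to up-sets and to their complements, and on which the determinant is available. Finite
  convex subsets of the plane form such a class: each is a skew shape, possibly disconnected and
  with empty rows. The cutting works because all marked values in the \<open>n\<close>-th dilation
  are multiples of \<open>n\<close>. Between two consecutive multiples a map is unconstrained by the
  marking, except that elements below a mark at the lower end are forced to stay there.\<close>

definition order_maps :: "('a \<times> 'a) set \<Rightarrow> 'a set \<Rightarrow> nat \<Rightarrow> ('a \<Rightarrow> nat) set" where
  "order_maps r Q n = {f \<in> Q \<rightarrow>\<^sub>E {..<n}. \<forall>p\<in>Q. \<forall>q\<in>Q. (p, q) \<in> r \<longrightarrow> f p \<le> f q}"

definition up_sets :: "('a \<times> 'a) set \<Rightarrow> 'a set \<Rightarrow> 'a set set" where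
  "up_sets r Q = {K. K \<subseteq> Q \<and> (\<forall>p\<in>K. \<forall>q\<in>Q. (p, q) \<in> r \<longrightarrow> q \<in> K)}"

text \<open>\<open>q\<close> ranges over the whole type and not over an ambient poset, so for an
  order on all of \<open>nat \<times> nat\<close> convexity refers to the full plane.\<close>

definition order_convex :: "('a \<times> 'a) set \<Rightarrow> 'a set \<Rightarrow> bool" where
  "order_convex r Q \<longleftrightarrow> (\<forall>p\<in>Q. \<forall>s\<in>Q. \<forall>q. (p, q) \<in> r \<longrightarrow> (q, s) \<in> r \<longrightarrow> q \<in> Q)"

definition nonneg_coeffs :: "real poly \<Rightarrow> bool" where
  "nonneg_coeffs p \<longleftrightarrow> (\<forall>k. 0 \<le> coeff p k)"

lemma finite_order_maps: "finite Q \<Longrightarrow> finite (order_maps r Q n)"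
  unfolding order_maps_def by (auto intro: finite_subset[OF _ finite_PiE[of Q "\<lambda>_. {..<n}"]])

lemma finite_up_sets: "finite Q \<Longrightarrow> finite (up_sets r Q)"
  unfolding up_sets_def by (auto intro: finite_subset[of _ "Pow Q"])

lemma order_maps_empty: "order_maps r {} n = {\<lambda>_. undefined}"
  unfolding order_maps_def by auto

lemma order_maps_zero: "Q \<noteq> {} \<Longrightarrow> order_maps r Q 0 = {}"
  unfolding order_maps_def by (auto simp: PiE_eq_empty_iff)

lemma order_maps_one: "order_maps r Q 1 = {\<lambda>p\<in>Q. 0}"
  unfolding order_maps_def by (auto simp: PiE_iff extensional_def restrict_def fun_eq_iff)

lemma order_convex_up_set:
  assumes "order_convex r Q" "K \<in> up_sets r Q"
  shows "order_convex r K" "order_convex r (Q - K)"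
  using assms unfolding order_convex_def up_sets_def by blast+

text \<open>\<open>K\<close> is the up-set on which the map has value at least \<open>n\<close>.\<close>

lemma card_order_maps_add:
  assumes fin: "finite Q"
  shows "card (order_maps r Q (n + m)) =
    (\<Sum>K\<in>up_sets r Q. card (order_maps r (Q - K) n) * card (order_maps r K m))"
proof -
  define F where "F = (\<lambda>f::'a \<Rightarrow> nat. ({p\<in>Q. n \<le> f p}, restrict f {p\<in>Q. f p < n},
    \<lambda>p\<in>{p\<in>Q. n \<le> f p}. f p - n))"
  define G where "G = (\<lambda>(K, g, h::'a \<Rightarrow> nat). \<lambda>p\<in>Q. if p \<in> K then h p + n else g p)"
  let ?S = "SIGMA K:up_sets r Q. order_maps r (Q - K) n \<times> order_maps r K m"
  have QK: "Q - {p\<in>Q. n \<le> f p} = {p\<in>Q. f p < n}" for f :: "'a \<Rightarrow> nat"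
    by auto
  have "bij_betw F (order_maps r Q (n + m)) ?S"
  proof (rule bij_betw_byWitness[where f' = G])
    show "\<forall>f\<in>order_maps r Q (n + m). G (F f) = f"
      by (auto simp: F_def G_def order_maps_def PiE_iff extensional_def fun_eq_iff)
    show "\<forall>x\<in>?S. F (G x) = x"
    proof safe
      fix K g h assume K: "K \<in> up_sets r Q" and g: "g \<in> order_maps r (Q - K) n"
        and h: "h \<in> order_maps r K m"
      have KQ: "K \<subseteq> Q" using K by (auto simp: up_sets_def)
      have gl: "g p < n" if "p \<in> Q" "p \<notin> K" for p
        using g that by (auto simp: order_maps_def PiE_iff)
      have 0: "n \<le> G (K, g, h) p \<longleftrightarrow> p \<in> K" if "p \<in> Q" for p
        using gl[OF that] that by (simp add: G_def not_le)
      have 1: "{p\<in>Q. n \<le> G (K, g, h) p} = K"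
        using KQ 0 by blast
      have 2: "{p\<in>Q. G (K, g, h) p < n} = Q - K"
        using 0 by (auto simp: not_le[symmetric])
      show "F (G (K, g, h)) = (K, g, h)"
        unfolding F_def 1 2 using g h KQ
        by (auto simp: G_def order_maps_def PiE_iff extensional_def fun_eq_iff)
    qed
    show "F ` order_maps r Q (n + m) \<subseteq> ?S"
    proof (rule image_subsetI)
      fix f assume f: "f \<in> order_maps r Q (n + m)"
      then have mono: "\<And>p q. p \<in> Q \<Longrightarrow> q \<in> Q \<Longrightarrow> (p, q) \<in> r \<Longrightarrow> f p \<le> f q"
        and bound: "\<And>p. p \<in> Q \<Longrightarrow> f p < n + m"
        by (auto simp: order_maps_def PiE_iff)
      have "{p\<in>Q. n \<le> f p} \<in> up_sets r Q"
        unfolding up_sets_def by (auto intro: order_trans mono)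
      moreover have "restrict f {p\<in>Q. f p < n} \<in> order_maps r {p\<in>Q. f p < n} n"
        unfolding order_maps_def by (auto intro: mono)
      moreover have "(\<lambda>p\<in>{p\<in>Q. n \<le> f p}. f p - n) \<in> order_maps r {p\<in>Q. n \<le> f p} m"
        unfolding order_maps_def using bound
        by (auto intro!: diff_le_mono intro: mono simp: less_diff_conv2 add.commute)
      ultimately show "F f \<in> ?S"
        by (simp add: F_def QK)
    qed
    show "G ` ?S \<subseteq> order_maps r Q (n + m)"
    proof safe
      fix K g h assume K: "K \<in> up_sets r Q" and g: "g \<in> order_maps r (Q - K) n"
        and h: "h \<in> order_maps r K m"
      have gl: "g p < n" if "p \<in> Q" "p \<notin> K" for p
        using g that by (auto simp: order_maps_def PiE_iff)
      have hl: "h p < m" if "p \<in> K" for p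
        using h that by (auto simp: order_maps_def PiE_iff)
      have "G (K, g, h) p \<le> G (K, g, h) q" if pq: "p \<in> Q" "q \<in> Q" "(p, q) \<in> r" for p q
      proof (cases "p \<in> K")
        case True
        then have "q \<in> K" using K pq by (auto simp: up_sets_def)
        then show ?thesis using h True pq by (auto simp: G_def order_maps_def)
      next
        case False
        then show ?thesis using g pq gl[of p] by (auto simp: G_def order_maps_def)
      qed
      moreover have "G (K, g, h) \<in> Q \<rightarrow>\<^sub>E {..<n + m}"
        using gl[THEN trans_less_add1] hl by (auto simp: G_def)
      ultimately show "G (K, g, h) \<in> order_maps r Q (n + m)"
        by (auto simp: order_maps_def)
    qed
  qed
  then have "card (order_maps r Q (n + m)) = card ?S"
    by (rule bij_betw_same_card)
  also have "\<dots> = (\<Sum>K\<in>up_sets r Q. card (order_maps r (Q - K) n \<times> order_maps r K m))"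
    by (rule card_SigmaI)
      (use fin in \<open>auto simp: finite_up_sets up_sets_def
         intro!: finite_cartesian_product finite_order_maps intro: finite_subset\<close>)
  finally show ?thesis
    by (simp add: card_cartesian_product)
qed

lemma poly_eqI_nat:
  fixes p q :: "real poly"
  assumes "\<And>n::nat. poly p (real n) = poly q (real n)"
  shows "p = q"
proof (rule ccontr)
  assume "p \<noteq> q"
  then have "finite {x. poly (p - q) x = 0}"
    by (intro poly_roots_finite) auto
  then have "finite (range real)"
    by (rule rev_finite_subset) (use assms in auto)
  then show False
    using finite_imageD[of real UNIV] by (auto simp: inj_on_def)
qed

text \<open>Differentiating \<open>\<omega> Q (n + m) = (\<Sum>K. \<omega> (Q - K) n * \<omega> K m)\<close> in \<open>m\<close> at \<open>m = 0\<close> expresses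
  the derivative of \<open>\<omega> Q\<close> by order polynomials of smaller posets and by linear coefficients.\<close>

lemma order_poly_nonneg_coeffs:
  fixes \<omega> :: "'a set \<Rightarrow> real poly"
  assumes \<omega>: "\<And>Q n. finite Q \<Longrightarrow> order_convex r Q \<Longrightarrow>
      poly (\<omega> Q) (real n) = real (card (order_maps r Q n))"
    and lin: "\<And>Q. finite Q \<Longrightarrow> order_convex r Q \<Longrightarrow> 0 \<le> coeff (\<omega> Q) 1"
    and "finite Q" "order_convex r Q"
  shows "nonneg_coeffs (\<omega> Q)"
  using assms(3,4)
proof (induction "card Q" arbitrary: Q rule: less_induct)
  case less
  note Q = less.prems
  have K: "finite K" "order_convex r K" "finite (Q - K)" "order_convex r (Q - K)"
    if "K \<in> up_sets r Q" for K
    using that Q order_convex_up_set[OF Q(2) that] by (auto simp: up_sets_def intro: finite_subset)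
  \<comment> \<open>Both sides are polynomials in the second summand, so the counting identity at
    natural numbers becomes one of polynomials, which can be differentiated.\<close>
  have *: "pcompose (\<omega> Q) [:real n, 1:] =
      (\<Sum>K\<in>up_sets r Q. Polynomial.smult (poly (\<omega> (Q - K)) (real n)) (\<omega> K))" for n
  proof (rule poly_eqI_nat)
    fix m
    have "poly (pcompose (\<omega> Q) [:real n, 1:]) (real m) = poly (\<omega> Q) (real (n + m))"
      by (simp add: poly_pcompose)
    also have "\<dots> = (\<Sum>K\<in>up_sets r Q. poly (\<omega> (Q - K)) (real n) * poly (\<omega> K) (real m))"
      unfolding \<omega>[OF Q] card_order_maps_add[OF Q(1)] using K by (simp add: \<omega>)
    finally show "poly (pcompose (\<omega> Q) [:real n, 1:]) (real m) =
        poly (\<Sum>K\<in>up_sets r Q. Polynomial.smult (poly (\<omega> (Q - K)) (real n)) (\<omega> K)) (real m)"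
      by (simp add: poly_sum)
  qed
  have pd: "pderiv (\<omega> Q) = (\<Sum>K\<in>up_sets r Q. Polynomial.smult (coeff (\<omega> K) 1) (\<omega> (Q - K)))"
  proof (rule poly_eqI_nat)
    fix n
    have "poly (pderiv (\<omega> Q)) (real n) = poly (pderiv (pcompose (\<omega> Q) [:real n, 1:])) 0"
      by (simp add: pderiv_pcompose poly_pcompose pderiv_pCons)
    also have "\<dots> = coeff (pcompose (\<omega> Q) [:real n, 1:]) 1"
      by (simp add: poly_0_coeff_0 coeff_pderiv)
    also have "\<dots> = (\<Sum>K\<in>up_sets r Q. poly (\<omega> (Q - K)) (real n) * coeff (\<omega> K) 1)"
      by (simp add: * coeff_sum)
    finally show "poly (pderiv (\<omega> Q)) (real n) =
        poly (\<Sum>K\<in>up_sets r Q. Polynomial.smult (coeff (\<omega> K) 1) (\<omega> (Q - K))) (real n)"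
      by (simp add: poly_sum mult.commute)
  qed
  have empty: "\<omega> {} = 1"
    by (rule poly_eqI_nat) (simp add: \<omega> order_convex_def order_maps_empty)
  \<comment> \<open>The term \<open>K = {}\<close>, for which \<open>Q - K\<close> is not smaller
    than \<open>Q\<close>, drops out because the constant polynomial \<open>\<omega> {} = 1\<close>
    has linear coefficient 0.\<close>
  have nn: "0 \<le> coeff (\<omega> K) 1 * coeff (\<omega> (Q - K)) k" if "K \<in> up_sets r Q" for K k
  proof (cases "K = {}")
    case True
    then show ?thesis by (simp add: empty)
  next
    case False
    have "K \<subseteq> Q" using that by (auto simp: up_sets_def)
    then have "card (Q - K) < card Q"
      using False Q(1) by (intro psubset_card_mono) auto
    from less.hyps[OF this K(3,4)[OF that]] show ?thesis
      using lin[OF K(1,2)[OF that]] by (auto simp: nonneg_coeffs_def)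
  qed
  have "0 \<le> coeff (\<omega> Q) k" for k
  proof (cases k)
    case 0
    have "coeff (\<omega> Q) 0 = poly (\<omega> Q) (real 0)" by (simp add: poly_0_coeff_0)
    then show ?thesis using 0 \<omega>[OF Q, of 0] by simp
  next
    case (Suc j)
    have "0 \<le> coeff (pderiv (\<omega> Q)) j"
      unfolding pd by (auto simp: coeff_sum intro!: sum_nonneg nn simp del: One_nat_def)
    then show ?thesis by (simp add: Suc coeff_pderiv zero_le_mult_iff)
  qed
  then show ?case by (simp add: nonneg_coeffs_def)
qed

section \<open>Marked order-preserving maps\<close>

text \<open>Marks are read on \<open>A \<inter> P\<close> so that the same \<open>A\<close> can be
  kept when the recursion replaces \<open>P\<close> by an up-set. The factor \<open>n\<close>
  encodes the dilation.\<close>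

definition marked_maps ::
    "('a \<times> 'a) set \<Rightarrow> 'a set \<Rightarrow> 'a set \<Rightarrow> ('a \<Rightarrow> nat) \<Rightarrow> nat \<Rightarrow> ('a \<Rightarrow> nat) set" where
  "marked_maps r P A l n = {f \<in> P \<rightarrow>\<^sub>E UNIV.
     (\<forall>p\<in>P. \<forall>q\<in>P. (p, q) \<in> r \<longrightarrow> f p \<le> f q) \<and> (\<forall>a\<in>A \<inter> P. f a = n * l a)}"

text \<open>Values are natural numbers, and a marked element above each \<open>p\<close> bounds them
  from above.\<close>

lemma finite_marked_maps:
  assumes "finite P" and hit: "\<And>p. p \<in> P \<Longrightarrow> \<exists>a\<in>A \<inter> P. (p, a) \<in> r"
  shows "finite (marked_maps r P A l n)"
proof -
  have "marked_maps r P A l n \<subseteq> P \<rightarrow>\<^sub>E {..n * (\<Sum>a\<in>A \<inter> P. l a)}"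
  proof
    fix f assume f: "f \<in> marked_maps r P A l n"
    have "f p \<le> n * (\<Sum>a\<in>A \<inter> P. l a)" if p: "p \<in> P" for p
    proof -
      obtain a where a: "a \<in> A \<inter> P" "(p, a) \<in> r" using hit[OF p] by blast
      then have "f p \<le> n * l a" using f p by (force simp: marked_maps_def)
      also have "\<dots> \<le> n * (\<Sum>a\<in>A \<inter> P. l a)"
        using a(1) assms(1) by (intro mult_le_mono2 member_le_sum) auto
      finally show ?thesis .
    qed
    then show "f \<in> P \<rightarrow>\<^sub>E {..n * (\<Sum>a\<in>A \<inter> P. l a)}"
      using f by (auto simp: marked_maps_def)
  qed
  then show ?thesis
    using assms(1) by (auto intro: finite_subset finite_PiE)
qed

lemma marked_maps_zero:
  assumes hit: "\<And>p. p \<in> P \<Longrightarrow> \<exists>a\<in>A \<inter> P. (p, a) \<in> r"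
  shows "marked_maps r P A l 0 = {\<lambda>p\<in>P. 0}"
proof -
  have "f p = 0" if "f \<in> marked_maps r P A l 0" "p \<in> P" for f p
    using hit[OF that(2)] that by (fastforce simp: marked_maps_def)
  then show ?thesis
    by (auto simp: marked_maps_def PiE_iff extensional_def fun_eq_iff)
qed

text \<open>A map is cut at the level \<open>n\<close>. Below that level it vanishes on the down-set \<open>D\<close> generated
  by the marked elements of value \<open>0\<close> and is otherwise unconstrained by the marking.\<close>

lemma card_marked_maps:
  fixes l :: "'a \<Rightarrow> nat"
  assumes fin: "finite P" and "trans r" and refl: "\<And>p. p \<in> P \<Longrightarrow> (p, p) \<in> r"
    and hit: "\<And>p. p \<in> P \<Longrightarrow> \<exists>a\<in>A \<inter> P. (p, a) \<in> r"
    and mono: "\<And>a b. a \<in> A \<inter> P \<Longrightarrow> b \<in> A \<inter> P \<Longrightarrow> (a, b) \<in> r \<Longrightarrow> l a \<le> l b"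
  defines "D \<equiv> {p\<in>P. \<exists>a\<in>A \<inter> P. l a = 0 \<and> (p, a) \<in> r}"
    and "U \<equiv> {K\<in>up_sets r P. \<forall>a\<in>A \<inter> P. a \<in> K \<longleftrightarrow> 0 < l a}"
  shows "card (marked_maps r P A l n) =
    (\<Sum>K\<in>U. card (order_maps r (P - K - D) n) * card (marked_maps r K A (\<lambda>a. l a - 1) n))"
proof -
  have D_down: "p \<in> D" if "q \<in> D" "p \<in> P" "(p, q) \<in> r" for p q
    using that \<open>trans r\<close> unfolding D_def by (blast dest: transD)
  have finU: "finite U"
    using finite_up_sets[OF fin] by (auto simp: U_def)
  have hitK: "\<exists>a\<in>A \<inter> K. (p, a) \<in> r" if "K \<in> U" "p \<in> K" for K p
  proof -
    have "p \<in> P" using that by (auto simp: U_def up_sets_def)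
    from hit[OF this] obtain a where "a \<in> A \<inter> P" "(p, a) \<in> r" by blast
    then show ?thesis using that by (auto simp: U_def up_sets_def)
  qed
  have finK: "finite (marked_maps r K A (\<lambda>a. l a - 1) n)" if "K \<in> U" for K
    using that fin hitK[OF that]
    by (intro finite_marked_maps) (auto simp: U_def up_sets_def intro: finite_subset)
  show ?thesis
  \<comment> \<open>Level 0 separates nothing: all elements would fall into the upper part,
    including those marked 0. Here both sides are 1, and on the right only \<open>K = P - D\<close>
    survives.\<close>
  proof (cases "n = 0")
    case True
    have "a \<in> P - D \<longleftrightarrow> 0 < l a" if a: "a \<in> A \<inter> P" for a
    proof (cases "l a")
      case 0
      then show ?thesis using a refl[of a] by (auto simp: D_def)
    next
      case (Suc k)
      then have "a \<notin> D" using mono[OF a] by (force simp: D_def)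
      then show ?thesis using a Suc by simp
    qed
    moreover have "P - D \<in> up_sets r P"
      unfolding up_sets_def using D_down by blast
    ultimately have "P - D \<in> U" by (simp add: U_def)
    have "card (order_maps r (P - K - D) n) * card (marked_maps r K A (\<lambda>a. l a - 1) n) =
        (if K = P - D then 1 else 0)" if K: "K \<in> U" for K
    proof (cases "P - K - D = {}")
      case True
      have "K \<inter> D = {}" "K \<subseteq> P" using K unfolding U_def up_sets_def D_def
        by (auto, metis IntI less_irrefl)
      with True have "K = P - D" by blast
      moreover have "card (marked_maps r K A (\<lambda>a. l a - 1) n) = 1"
        using hitK[OF K] by (simp add: \<open>n = 0\<close> marked_maps_zero)
      moreover have "card (order_maps r (P - K - D) n) = 1"
        unfolding True by (simp add: order_maps_empty)
      ultimately show ?thesis by simp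
    next
      case False
      then have "K \<noteq> P - D" by blast
      then show ?thesis using False \<open>n = 0\<close> by (simp add: order_maps_zero)
    qed
    then have "(\<Sum>K\<in>U. card (order_maps r (P - K - D) n) * card (marked_maps r K A (\<lambda>a. l a - 1) n))
        = (\<Sum>K\<in>U. if K = P - D then 1 else 0)"
      by (intro sum.cong) auto
    also have "\<dots> = 1" using \<open>P - D \<in> U\<close> finU by simp
    finally show ?thesis using True by (simp add: marked_maps_zero[OF hit])
  next
    case False
    then have n: "0 < n" by simp
    define F where "F = (\<lambda>f::'a \<Rightarrow> nat. ({p\<in>P. n \<le> f p}, restrict f (P - {p\<in>P. n \<le> f p} - D),
      \<lambda>p\<in>{p\<in>P. n \<le> f p}. f p - n))"
    define G where "G = (\<lambda>(K, g, h::'a \<Rightarrow> nat).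
      \<lambda>p\<in>P. if p \<in> K then h p + n else if p \<in> D then 0 else g p)"
    let ?S = "SIGMA K:U. order_maps r (P - K - D) n \<times> marked_maps r K A (\<lambda>a. l a - 1) n"
    \<comment> \<open>The value 0 that \<open>G\<close> puts on \<open>D\<close> is below the level
      because \<open>n\<close> is positive.\<close>
    have G_level: "n \<le> G (K, g, h) p \<longleftrightarrow> p \<in> K"
      if "p \<in> P" "g \<in> order_maps r (P - K - D) n" for K g h p
      using that n by (auto simp: G_def order_maps_def PiE_iff not_le)
    have bij: "bij_betw F (marked_maps r P A l n) ?S"
    proof (rule bij_betw_byWitness[where f' = G])
      have zero: "f p = 0" if "f \<in> marked_maps r P A l n" "p \<in> D" for f p
        using that by (fastforce simp: marked_maps_def D_def)
      show "\<forall>f\<in>marked_maps r P A l n. G (F f) = f"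
      proof
        fix f assume f: "f \<in> marked_maps r P A l n"
        then have "f \<in> extensional P" by (simp add: marked_maps_def PiE_iff)
        moreover have "G (F f) p = f p" if "p \<in> P" for p
          using zero[OF f] that by (auto simp: F_def G_def)
        ultimately show "G (F f) = f"
          by (intro extensionalityI[of _ P]) (auto simp: F_def G_def)
      qed
      show "\<forall>x\<in>?S. F (G x) = x"
      proof safe
        fix K g h assume K: "K \<in> U" and g: "g \<in> order_maps r (P - K - D) n"
          and h: "h \<in> marked_maps r K A (\<lambda>a. l a - 1) n"
        have KP: "K \<subseteq> P" using K by (auto simp: U_def up_sets_def)
        have 1: "{p\<in>P. n \<le> G (K, g, h) p} = K"
          using KP G_level[OF _ g] by blast
        have "restrict (G (K, g, h)) (P - K - D) = g"
          using g by (intro extensionalityI[of _ "P - K - D"]) (auto simp: G_def order_maps_def PiE_iff)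
        moreover have "(\<lambda>p\<in>K. G (K, g, h) p - n) = h"
          using h KP by (intro extensionalityI[of _ K]) (auto simp: G_def marked_maps_def PiE_iff)
        ultimately show "F (G (K, g, h)) = (K, g, h)"
          unfolding F_def 1 by simp
      qed
      show "F ` marked_maps r P A l n \<subseteq> ?S"
      proof (rule image_subsetI)
        fix f assume f: "f \<in> marked_maps r P A l n"
        then have mono_f: "\<And>p q. p \<in> P \<Longrightarrow> q \<in> P \<Longrightarrow> (p, q) \<in> r \<Longrightarrow> f p \<le> f q"
          and mark: "\<And>a. a \<in> A \<Longrightarrow> a \<in> P \<Longrightarrow> f a = n * l a"
          by (auto simp: marked_maps_def)
        \<comment> \<open>Marked values are multiples of \<open>n\<close>, so the upper part
          contains exactly the marked elements with positive mark.\<close>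
        have "n \<le> n * l a \<longleftrightarrow> 0 < l a" for a
          using n by (cases "l a") auto
        then have "{p\<in>P. n \<le> f p} \<in> U"
          unfolding U_def up_sets_def by (auto simp: mark intro: order_trans mono_f)
        moreover have "restrict f (P - {p\<in>P. n \<le> f p} - D)
            \<in> order_maps r (P - {p\<in>P. n \<le> f p} - D) n"
          unfolding order_maps_def by (auto intro: mono_f)
        moreover have "(\<lambda>p\<in>{p\<in>P. n \<le> f p}. f p - n)
            \<in> marked_maps r {p\<in>P. n \<le> f p} A (\<lambda>a. l a - 1) n"
          unfolding marked_maps_def
          by (auto intro!: diff_le_mono intro: mono_f simp: mark diff_mult_distrib2)
        ultimately show "F f \<in> ?S"
          by (simp add: F_def)
      qed
      show "G ` ?S \<subseteq> marked_maps r P A l n"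
      proof safe
        fix K g h assume K: "K \<in> U" and g: "g \<in> order_maps r (P - K - D) n"
          and h: "h \<in> marked_maps r K A (\<lambda>a. l a - 1) n"
        have "G (K, g, h) p \<le> G (K, g, h) q" if pq: "p \<in> P" "q \<in> P" "(p, q) \<in> r" for p q
        proof (cases "p \<in> K")
          case True
          then have "q \<in> K" using K pq by (auto simp: U_def up_sets_def)
          then show ?thesis using h True pq by (auto simp: G_def marked_maps_def)
        next
          case False
          then show ?thesis
          proof (cases "q \<in> K")
            case True
            then show ?thesis using False G_level[OF pq(1) g] G_level[OF pq(2) g]
              by (meson nat_le_linear order_trans)
          next
            case q: False
            then show ?thesis using g pq D_down[OF _ pq(1,3)] \<open>p \<notin> K\<close>
              by (auto simp: G_def order_maps_def)
          qed
        qed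
        moreover have "G (K, g, h) a = n * l a" if a: "a \<in> A" "a \<in> P" for a
        proof (cases "l a")
          case 0
          then have "a \<notin> K" "a \<in> D" using K a refl by (auto simp: U_def D_def)
          then show ?thesis using 0 a by (simp add: G_def)
        next
          case (Suc k)
          then have "a \<in> K" using K a by (auto simp: U_def)
          then show ?thesis using Suc a h by (auto simp: G_def marked_maps_def)
        qed
        ultimately show "G (K, g, h) \<in> marked_maps r P A l n"
          by (auto simp: marked_maps_def G_def)
      qed
    qed
    have "card (marked_maps r P A l n) = card ?S"
      using bij by (rule bij_betw_same_card)
    also have "\<dots> = (\<Sum>K\<in>U.
        card (order_maps r (P - K - D) n \<times> marked_maps r K A (\<lambda>a. l a - 1) n))"
      using finU finK fin by (intro card_SigmaI) (auto intro!: finite_order_maps)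
    finally show ?thesis
      by (simp add: card_cartesian_product)
  qed
qed

lemma nonneg_coeffs_mult: "nonneg_coeffs p \<Longrightarrow> nonneg_coeffs q \<Longrightarrow> nonneg_coeffs (p * q)"
  by (auto simp: nonneg_coeffs_def coeff_mult intro!: sum_nonneg)

lemma nonneg_coeffs_sum: "(\<And>x. x \<in> S \<Longrightarrow> nonneg_coeffs (f x)) \<Longrightarrow> nonneg_coeffs (sum f S)"
  by (auto simp: nonneg_coeffs_def coeff_sum intro!: sum_nonneg)

text \<open>Induction on a strict bound \<open>m\<close> for the marks: each cut lowers the marks
  that remain by 1. They are all positive on \<open>K\<close>, so the subtraction does not truncate.
  The set \<open>P0\<close> stays fixed so that the assumptions on \<omega> cover every
  stage.\<close>

lemma marked_maps_poly:
  fixes l :: "'a \<Rightarrow> nat" and \<omega> :: "'a set \<Rightarrow> real poly"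
  assumes "trans r"
    and \<omega>: "\<And>Q n. Q \<subseteq> P0 \<Longrightarrow> order_convex r Q \<Longrightarrow> poly (\<omega> Q) (real n) = real (card (order_maps r Q n))"
    and nn: "\<And>Q. Q \<subseteq> P0 \<Longrightarrow> order_convex r Q \<Longrightarrow> nonneg_coeffs (\<omega> Q)"
    and "finite P0" and refl: "\<And>p. p \<in> P0 \<Longrightarrow> (p, p) \<in> r"
    and "P \<subseteq> P0" "order_convex r P"
    and "\<And>p. p \<in> P \<Longrightarrow> \<exists>a\<in>A \<inter> P. (p, a) \<in> r"
    and "\<And>a b. a \<in> A \<inter> P \<Longrightarrow> b \<in> A \<inter> P \<Longrightarrow> (a, b) \<in> r \<Longrightarrow> l a \<le> l b"
    and "\<And>a. a \<in> A \<inter> P \<Longrightarrow> l a < m"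
  shows "\<exists>E. nonneg_coeffs E \<and> (\<forall>n. poly E (real n) = real (card (marked_maps r P A l n)))"
  using assms(6-)
proof (induction m arbitrary: P l)
  case 0
  \<comment> \<open>No mark is smaller than 0, so \<open>P\<close> has no marked element, yet every
    element needs one above it.\<close>
  then have "P = {}" by fastforce
  then have "marked_maps r P A l n = {\<lambda>_. undefined}" for n
    by (auto simp: marked_maps_def)
  then show ?case
    by (intro exI[of _ 1]) (auto simp: nonneg_coeffs_def coeff_1)
next
  case (Suc m)
  define D where "D = {p\<in>P. \<exists>a\<in>A \<inter> P. l a = 0 \<and> (p, a) \<in> r}"
  define U where "U = {K\<in>up_sets r P. \<forall>a\<in>A \<inter> P. a \<in> K \<longleftrightarrow> 0 < l a}"
  have finP: "finite P" using Suc.prems(1) \<open>finite P0\<close> by (rule finite_subset)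
  have card: "card (marked_maps r P A l n) =
      (\<Sum>K\<in>U. card (order_maps r (P - K - D) n) * card (marked_maps r K A (\<lambda>a. l a - 1) n))" for n
    unfolding U_def D_def using Suc.prems assms(1) refl finP by (intro card_marked_maps) auto
  have "\<exists>E. nonneg_coeffs E \<and>
      (\<forall>n. poly E (real n) = real (card (marked_maps r K A (\<lambda>a. l a - 1) n)))" if K: "K \<in> U" for K
  proof (rule Suc.IH)
    have KP: "K \<in> up_sets r P" "K \<subseteq> P" using K by (auto simp: U_def up_sets_def)
    show "K \<subseteq> P0" using KP Suc.prems(1) by auto
    show "order_convex r K" using order_convex_up_set[OF Suc.prems(2) KP(1)] by simp
    show "\<exists>a\<in>A \<inter> K. (p, a) \<in> r" if "p \<in> K" for p
      using Suc.prems(3)[of p] KP that by (auto simp: up_sets_def)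
    show "l a - 1 \<le> l b - 1" if "a \<in> A \<inter> K" "b \<in> A \<inter> K" "(a, b) \<in> r" for a b
      using Suc.prems(4)[of a b] KP that by (intro diff_le_mono) auto
    show "l a - 1 < m" if "a \<in> A \<inter> K" for a
      using Suc.prems(5)[of a] K that KP(2) by (force simp: U_def)
  qed
  then obtain E where E: "\<And>K. K \<in> U \<Longrightarrow> nonneg_coeffs (E K)"
    "\<And>K n. K \<in> U \<Longrightarrow> poly (E K) (real n) = real (card (marked_maps r K A (\<lambda>a. l a - 1) n))"
    by metis
  \<comment> \<open>Removing the up-set \<open>K\<close> and the down-set \<open>D\<close> preserves
    convexity.\<close>
  have Q: "P - K - D \<subseteq> P0" "order_convex r (P - K - D)" if "K \<in> U" for K
  proof -
    show "P - K - D \<subseteq> P0" using Suc.prems(1) by auto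
    show "order_convex r (P - K - D)"
      unfolding order_convex_def
    proof (intro ballI allI impI)
      fix p s q assume p: "p \<in> P - K - D" and s: "s \<in> P - K - D" and pq: "(p, q) \<in> r" "(q, s) \<in> r"
      have "q \<in> P" using Suc.prems(2) p s pq by (auto simp: order_convex_def)
      moreover have "q \<notin> K" using that s pq(2) by (auto simp: U_def up_sets_def)
      moreover have "q \<notin> D"
      proof
        assume "q \<in> D"
        then obtain a where "a \<in> A \<inter> P" "l a = 0" "(q, a) \<in> r" by (auto simp: D_def)
        then have "p \<in> D" using p transD[OF assms(1) pq(1)] by (auto simp: D_def)
        with p show False by simp
      qed
      ultimately show "q \<in> P - K - D" by blast
    qed
  qed
  show ?case
    by (intro exI[of _ "\<Sum>K\<in>U. \<omega> (P - K - D) * E K"])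
      (auto simp: card poly_sum \<omega> E Q nn intro!: nonneg_coeffs_sum nonneg_coeffs_mult)
qed

section \<open>Marked order polytopes\<close>

lemma finite_convex_hull_combination:
  assumes "g \<in> finite_convex_hull I V" "h \<in> finite_convex_hull I V" "0 \<le> t" "t \<le> 1"
  shows "(\<lambda>i\<in>I. (1 - t) * g i + t * h i) \<in> finite_convex_hull I V"
proof -
  obtain c d where c: "g = (\<lambda>i\<in>I. \<Sum>v\<in>V. c v * v i)" "\<forall>v\<in>V. 0 \<le> c v" "(\<Sum>v\<in>V. c v) = 1"
    and d: "h = (\<lambda>i\<in>I. \<Sum>v\<in>V. d v * v i)" "\<forall>v\<in>V. 0 \<le> d v" "(\<Sum>v\<in>V. d v) = 1"
    using assms(1,2) unfolding finite_convex_hull_def by auto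
  let ?e = "\<lambda>v. (1 - t) * c v + t * d v"
  have "(\<lambda>i\<in>I. (1 - t) * g i + t * h i) = (\<lambda>i\<in>I. \<Sum>v\<in>V. ?e v * v i)"
    by (simp add: c(1) d(1) sum_distrib_left distrib_right sum.distrib mult.assoc cong: restrict_cong)
  moreover have "\<forall>v\<in>V. 0 \<le> ?e v" using c d assms by auto
  moreover have "(\<Sum>v\<in>V. ?e v) = 1"
    using c d by (simp add: sum.distrib flip: sum_distrib_left)
  ultimately show ?thesis
    unfolding finite_convex_hull_def by (intro CollectI exI[of _ ?e]) simp
qed

lemma finite_convex_hull_superset:
  assumes "finite V" "v \<in> V" "v \<in> extensional I"
  shows "v \<in> finite_convex_hull I V"
proof -
  have "(\<Sum>w\<in>V. (if w = v then 1 else 0) * w i) = (\<Sum>w\<in>V. if w = v then v i else 0)" for i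
    by (intro sum.cong) auto
  then have "v = (\<lambda>i\<in>I. \<Sum>w\<in>V. (if w = v then 1 else 0) * w i)"
    using assms by (intro extensionalityI[of _ I]) simp_all
  then show ?thesis
    unfolding finite_convex_hull_def using assms
    by (intro CollectI exI[of _ "\<lambda>w. if w = v then 1 else 0"]) auto
qed

lemma marked_order_polytopeD:
  assumes "f \<in> marked_order_polytope P r A l"
  shows "p \<in> P \<Longrightarrow> q \<in> P \<Longrightarrow> (p, q) \<in> r \<Longrightarrow> f p \<le> f q"
    and "a \<in> A \<Longrightarrow> f a = of_int (l a)"
    and "f \<in> extensional P"
  using assms by (auto simp: marked_order_polytope_def PiE_iff)

lemma marked_order_polytope_bound:
  assumes "finite A"
    and above: "\<And>p. p \<in> P \<Longrightarrow> \<exists>a\<in>A. (p, a) \<in> r" and below: "\<And>p. p \<in> P \<Longrightarrow> \<exists>a\<in>A. (a, p) \<in> r"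
    and "A \<subseteq> P" "f \<in> marked_order_polytope P r A l" "p \<in> P"
  shows "\<bar>f p\<bar> \<le> of_int (\<Sum>a\<in>A. \<bar>l a\<bar>)"
proof -
  obtain a b where ab: "a \<in> A" "(a, p) \<in> r" "b \<in> A" "(p, b) \<in> r"
    using above below assms(6) by blast
  have "of_int (l a) \<le> f p" "f p \<le> of_int (l b)"
    using marked_order_polytopeD(1,2)[OF assms(5)] assms(4,6) ab by (metis subsetD)+
  moreover have "\<bar>l a\<bar> \<le> (\<Sum>a\<in>A. \<bar>l a\<bar>)" "\<bar>l b\<bar> \<le> (\<Sum>a\<in>A. \<bar>l a\<bar>)"
    using ab assms(1) by (auto intro!: member_le_sum)
  ultimately show ?thesis by linarith
qed

text \<open>A non-integral point lies on the segment from its pointwise floor to the point whose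
  fractional parts are divided by the largest one.\<close>

lemma marked_order_polytope_subset_hull:
  assumes "finite P" and "A \<subseteq> P"
    and "finite V" and V: "V = marked_order_polytope P r A l \<inter> (P \<rightarrow>\<^sub>E \<int>)"
    and "f \<in> marked_order_polytope P r A l"
  shows "f \<in> finite_convex_hull P V"
  using assms(5)
proof (induction "card {p\<in>P. f p \<notin> \<int>}" arbitrary: f rule: less_induct)
  case less
  define S where "S = {p\<in>P. f p \<notin> \<int>}"
  have finS: "finite S" using assms(1) by (simp add: S_def)
  have ext: "f \<in> extensional P"
    and mono: "\<And>p q. p \<in> P \<Longrightarrow> q \<in> P \<Longrightarrow> (p, q) \<in> r \<Longrightarrow> f p \<le> f q"
    and mark: "\<And>a. a \<in> A \<Longrightarrow> f a = of_int (l a)"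
    using less.prems by (auto simp: marked_order_polytope_def PiE_iff)
  show ?case
  proof (cases "S = {}")
    case True
    then have "f \<in> V" using ext less.prems by (auto simp: V S_def PiE_iff)
    then show ?thesis using finite_convex_hull_superset[OF assms(3)] ext by blast
  next
    case False
    define t where "t = Max ((\<lambda>p. frac (f p)) ` S)"
    have "t \<in> (\<lambda>p. frac (f p)) ` S" unfolding t_def using finS False by (intro Max_in) auto
    then obtain p0 where p0: "p0 \<in> S" "t = frac (f p0)" by auto
    have t: "0 < t" "t < 1" using p0 by (auto simp: S_def frac_gt_0_iff frac_lt_1)
    have frac_le: "frac (f p) \<le> t" if "p \<in> P" for p
    proof (cases "p \<in> S")
      case True
      then show ?thesis unfolding t_def using finS by (intro Max_ge) auto
    next
      case False
      then show ?thesis using that t by (simp add: S_def frac_eq_0_iff[THEN iffD2])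
    qed
    define g where "g = (\<lambda>p\<in>P. real_of_int \<lfloor>f p\<rfloor>)"
    define h where "h = (\<lambda>p\<in>P. real_of_int \<lfloor>f p\<rfloor> + frac (f p) / t)"
    have "g \<in> V"
      using assms(2) by (auto simp: V marked_order_polytope_def g_def mark subset_iff
        intro!: floor_mono mono)
    then have g: "g \<in> finite_convex_hull P V"
      by (rule finite_convex_hull_superset[OF assms(3)]) (simp add: g_def)
    have "h \<in> marked_order_polytope P r A l"
    proof -
      have "h p \<le> h q" if pq: "p \<in> P" "q \<in> P" "(p, q) \<in> r" for p q
      proof (cases "\<lfloor>f p\<rfloor> = \<lfloor>f q\<rfloor>")
        case True
        then show ?thesis using mono[OF pq] pq t by (simp add: h_def frac_def divide_right_mono)
      next
        case False
        \<comment> \<open>Different floors leave a gap of at least 1, which absorbs the rescaled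
          fractional part of \<open>f p\<close>.\<close>
        then have "\<lfloor>f p\<rfloor> + 1 \<le> \<lfloor>f q\<rfloor>" using floor_mono[OF mono[OF pq]] by linarith
        moreover have "frac (f p) / t \<le> 1" using frac_le[OF pq(1)] t by simp
        moreover have "0 \<le> frac (f q) / t" using t by (simp add: frac_ge_0)
        ultimately show ?thesis using pq by (simp add: h_def)
      qed
      then show ?thesis
        using assms(2) by (auto simp: marked_order_polytope_def h_def mark subset_iff)
    qed
    \<comment> \<open>Integral coordinates are unchanged, and at \<open>p0\<close> the rescaled
      fractional part is 1.\<close>
    moreover have "card {p\<in>P. h p \<notin> \<int>} < card S"
    proof (intro psubset_card_mono finS)
      have "h p \<in> \<int>" if "p \<in> P" "p \<notin> S" for p
        using that by (simp add: h_def S_def frac_eq_0_iff[THEN iffD2])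
      moreover have "h p0 \<in> \<int>" using p0 t by (auto simp: h_def S_def)
      ultimately show "{p\<in>P. h p \<notin> \<int>} \<subset> S" using p0(1) by blast
    qed
    ultimately have h: "h \<in> finite_convex_hull P V"
      using less.hyps[of h] by (simp add: S_def)
    have "f = (\<lambda>p\<in>P. (1 - t) * g p + t * h p)"
    proof (rule extensionalityI[OF ext])
      fix p assume "p \<in> P"
      have "(1 - t) * real_of_int \<lfloor>f p\<rfloor> + t * (real_of_int \<lfloor>f p\<rfloor> + frac (f p) / t) = f p"
        using t by (simp add: field_simps frac_def)
      then show "f p = (\<lambda>p\<in>P. (1 - t) * g p + t * h p) p"
        using \<open>p \<in> P\<close> by (simp add: g_def h_def)
    qed auto
    then show ?thesis
      using finite_convex_hull_combination[OF g h] t by simp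
  qed
qed

lemma finite_convex_hull_subset_marked_order_polytope:
  assumes "V \<subseteq> marked_order_polytope P r A l" "A \<subseteq> P"
  shows "finite_convex_hull P V \<subseteq> marked_order_polytope P r A l"
proof
  fix f assume "f \<in> finite_convex_hull P V"
  then obtain c where c: "f = (\<lambda>i\<in>P. \<Sum>v\<in>V. c v * v i)" "\<forall>v\<in>V. 0 \<le> c v" "(\<Sum>v\<in>V. c v) = 1"
    by (auto simp: finite_convex_hull_def)
  have "f p \<le> f q" if "p \<in> P" "q \<in> P" "(p, q) \<in> r" for p q
    using that c(2) assms(1)
    by (auto simp: c(1) marked_order_polytope_def intro!: sum_mono mult_left_mono)
  moreover have "f a = of_int (l a)" if a: "a \<in> A" for a
  proof -
    have "f a = (\<Sum>v\<in>V. c v * of_int (l a))"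
      using a assms by (auto simp: c(1) marked_order_polytope_def intro!: sum.cong)
    then show ?thesis by (simp add: c(3) flip: sum_distrib_right)
  qed
  ultimately show "f \<in> marked_order_polytope P r A l"
    by (auto simp: marked_order_polytope_def c(1))
qed

text \<open>All lattice points of the polytope serve as \<open>V\<close>, which avoids describing
  the vertices. They are finitely many because each coordinate lies between two marks.\<close>

lemma lattice_marked_order_polytope:
  assumes "finite P" "A \<subseteq> P"
    and "\<And>p. p \<in> P \<Longrightarrow> \<exists>a\<in>A. (p, a) \<in> r" "\<And>p. p \<in> P \<Longrightarrow> \<exists>a\<in>A. (a, p) \<in> r"
  shows "lattice_polytope P (marked_order_polytope P r A l)"
proof -
  define V where "V = marked_order_polytope P r A l \<inter> (P \<rightarrow>\<^sub>E \<int>)"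
  define N where "N = (\<Sum>a\<in>A. \<bar>l a\<bar>)"
  have finA: "finite A" using assms(1,2) by (rule rev_finite_subset)
  have "V \<subseteq> P \<rightarrow>\<^sub>E real_of_int ` {-N..N}"
  proof
    fix f assume f: "f \<in> V"
    have "f p \<in> real_of_int ` {-N..N}" if p: "p \<in> P" for p
    proof -
      have "f p \<in> \<int>" using f p by (auto simp: V_def PiE_iff)
      then obtain z where z: "f p = of_int z" by (auto elim: Ints_cases)
      have "\<bar>f p\<bar> \<le> of_int N"
        unfolding N_def using f p by (intro marked_order_polytope_bound[OF finA assms(3,4,2)]) (auto simp: V_def)
      then have "z \<in> {-N..N}" unfolding z by auto
      then show ?thesis using z by blast
    qed
    then show "f \<in> P \<rightarrow>\<^sub>E real_of_int ` {-N..N}" using f by (auto simp: V_def PiE_iff)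
  qed
  then have finV: "finite V"
    by (rule finite_subset) (simp add: assms(1) finite_PiE)
  show ?thesis
    unfolding lattice_polytope_def
  proof (intro exI conjI)
    show "marked_order_polytope P r A l = finite_convex_hull P V"
      using marked_order_polytope_subset_hull[OF assms(1,2) finV V_def]
        finite_convex_hull_subset_marked_order_polytope[of V P r A l] assms(2)
      by (auto simp: V_def)
  qed (use finV in \<open>auto simp: V_def\<close>)
qed

text \<open>Division by \<open>n\<close> inverts the dilation for positive \<open>n\<close>. At
  \<open>n = 0\<close> the right-hand side is the zero map, squeezed between marks 0, so equality
  there depends on the polytope being nonempty.\<close>

lemma dilate_marked_order_polytope:
  assumes "A \<subseteq> P"
    and above: "\<And>p. p \<in> P \<Longrightarrow> \<exists>a\<in>A. (p, a) \<in> r" and below: "\<And>p. p \<in> P \<Longrightarrow> \<exists>a\<in>A. (a, p) \<in> r"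
    and ne: "marked_order_polytope P r A l \<noteq> {}"
  shows "dilate P n (marked_order_polytope P r A l) = marked_order_polytope P r A (\<lambda>a. int n * l a)"
proof
  show "dilate P n (marked_order_polytope P r A l) \<subseteq> marked_order_polytope P r A (\<lambda>a. int n * l a)"
    using assms(1) by (auto simp: dilate_def marked_order_polytope_def subset_iff intro!: mult_left_mono)
  show "marked_order_polytope P r A (\<lambda>a. int n * l a) \<subseteq> dilate P n (marked_order_polytope P r A l)"
  proof
    fix f assume f: "f \<in> marked_order_polytope P r A (\<lambda>a. int n * l a)"
    then have ext: "f \<in> extensional P" by (auto simp: marked_order_polytope_def PiE_iff)
    show "f \<in> dilate P n (marked_order_polytope P r A l)"
    proof (cases "n = 0")
      case True
      have "f p = 0" if p: "p \<in> P" for p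
      proof -
        obtain a b where ab: "a \<in> A" "(a, p) \<in> r" "b \<in> A" "(p, b) \<in> r"
          using above[OF p] below[OF p] by blast
        then have "a \<in> P" "b \<in> P" using assms(1) by auto
        then have "f a \<le> f p" "f p \<le> f b"
          using marked_order_polytopeD(1)[OF f] p ab by blast+
        moreover have "f a = 0" "f b = 0"
          using marked_order_polytopeD(2)[OF f] ab True by simp_all
        ultimately show ?thesis by simp
      qed
      moreover obtain f0 where "f0 \<in> marked_order_polytope P r A l" using ne by blast
      ultimately show ?thesis using True ext
        unfolding dilate_def by (intro image_eqI[of _ _ f0] extensionalityI[of _ P]) auto
    next
      case False
      let ?g = "\<lambda>p\<in>P. f p / real n"
      have "?g \<in> marked_order_polytope P r A l"
        using f False assms(1)
        by (auto simp: marked_order_polytope_def divide_right_mono subset_iff)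
      moreover have "f = (\<lambda>i\<in>P. real n * ?g i)"
        using ext False by (intro extensionalityI[of _ P]) auto
      ultimately show ?thesis unfolding dilate_def by blast
    qed
  qed
qed

text \<open>Shifting by \<open>n * c\<close> rather than by a constant makes the shifted marks
  \<open>n\<close> times the fixed numbers \<open>l a - c\<close>. A marked element below each
  \<open>p\<close> keeps all values at least \<open>n * c\<close>, so \<open>nat\<close> does not
  truncate.\<close>

lemma bij_betw_marked_maps:
  fixes l :: "'a \<Rightarrow> int"
  assumes "A \<subseteq> P" and below: "\<And>p. p \<in> P \<Longrightarrow> \<exists>a\<in>A. (a, p) \<in> r" and c: "\<And>a. a \<in> A \<Longrightarrow> c \<le> l a"
  shows "bij_betw (\<lambda>g. \<lambda>p\<in>P. real (g p) + of_int (int n * c))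
    (marked_maps r P A (\<lambda>a. nat (l a - c)) n)
    (marked_order_polytope P r A (\<lambda>a. int n * l a) \<inter> (P \<rightarrow>\<^sub>E \<int>))"
proof (rule bij_betw_byWitness[where f' = "\<lambda>f. \<lambda>p\<in>P. nat (\<lfloor>f p\<rfloor> - int n * c)"])
  let ?M = "marked_maps r P A (\<lambda>a. nat (l a - c)) n"
  let ?L = "marked_order_polytope P r A (\<lambda>a. int n * l a) \<inter> (P \<rightarrow>\<^sub>E \<int>)"
  let ?F = "\<lambda>g. \<lambda>p\<in>P. real (g p) + of_int (int n * c)"
  let ?G = "\<lambda>f. \<lambda>p\<in>P. nat (\<lfloor>f p :: real\<rfloor> - int n * c)"
  have fl: "\<lfloor>real k + of_int z\<rfloor> - z = int k" for k z by simp
  show "\<forall>g\<in>?M. ?G (?F g) = g"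
  proof
    fix g assume "g \<in> ?M"
    then show "?G (?F g) = g"
      by (intro extensionalityI[of _ P])
        (auto simp: marked_maps_def PiE_iff fl simp del: of_int_mult of_int_of_nat_eq)
  qed
  have low: "int n * c \<le> \<lfloor>f p\<rfloor>" if f: "f \<in> ?L" and p: "p \<in> P" for f p
  proof -
    obtain a where a: "a \<in> A" "(a, p) \<in> r" using below[OF p] by blast
    have "real_of_int (int n * c) \<le> of_int (int n * l a)"
      unfolding of_int_le_iff using c[OF a(1)] by (rule mult_left_mono) simp
    also have "\<dots> \<le> f p"
      using marked_order_polytopeD[of f] f p a assms(1) by (metis IntD1 subsetD)
    finally show ?thesis by (simp only: le_floor_iff)
  qed
  show "\<forall>f\<in>?L. ?F (?G f) = f"
  proof
    fix f assume f: "f \<in> ?L"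
    show "?F (?G f) = f"
    proof (rule extensionalityI[of _ P])
      fix p assume p: "p \<in> P"
      have "f p \<in> \<int>" using f p by (auto simp: PiE_iff)
      then have "real_of_int \<lfloor>f p\<rfloor> = f p" by (auto elim: Ints_cases)
      moreover have "real (nat (\<lfloor>f p\<rfloor> - int n * c)) = of_int (\<lfloor>f p\<rfloor> - int n * c)"
        using low[OF f p] by simp
      ultimately show "?F (?G f) p = f p" using p by simp
    qed (use f in \<open>auto simp: PiE_iff\<close>)
  qed
  show "?F ` ?M \<subseteq> ?L"
  proof (rule image_subsetI)
    fix g assume g: "g \<in> ?M"
    have "real (g a) + of_int (int n * c) = of_int (int n * l a)" if "a \<in> A" for a
    proof -
      have "int (g a) = int n * (l a - c)"
        using g that assms(1) c[OF that] by (auto simp: marked_maps_def subset_iff)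
      then have "int (g a) + int n * c = int n * l a" by (simp add: algebra_simps)
      then show ?thesis by (metis of_int_add of_int_of_nat_eq)
    qed
    then show "?F g \<in> ?L"
      using g assms(1) by (auto simp: marked_order_polytope_def marked_maps_def subset_iff
        simp del: of_int_mult)
  qed
  show "?G ` ?L \<subseteq> ?M"
  proof (rule image_subsetI)
    fix f assume f: "f \<in> ?L"
    have "nat (\<lfloor>f a\<rfloor> - int n * c) = n * nat (l a - c)" if "a \<in> A" for a
    proof -
      have "f a = of_int (int n * l a)" using f that by (auto simp: marked_order_polytope_def)
      then have "\<lfloor>f a\<rfloor> - int n * c = int n * (l a - c)"
        by (simp only: floor_of_int right_diff_distrib)
      then show ?thesis by (simp add: nat_mult_distrib)
    qed
    then show "?G f \<in> ?M"
      using f assms(1) by (auto simp: marked_order_polytope_def marked_maps_def subset_iff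
        intro!: nat_mono diff_right_mono floor_mono)
  qed
qed

lemma ehrhart_positive_marked_order_polytope:
  fixes \<omega> :: "'a set \<Rightarrow> real poly"
  assumes "finite P" "trans r" "\<And>p. p \<in> P \<Longrightarrow> (p, p) \<in> r" "order_convex r P" "A \<subseteq> P"
    and above: "\<And>p. p \<in> P \<Longrightarrow> \<exists>a\<in>A. (p, a) \<in> r" and below: "\<And>p. p \<in> P \<Longrightarrow> \<exists>a\<in>A. (a, p) \<in> r"
    and \<omega>: "\<And>Q n. Q \<subseteq> P \<Longrightarrow> order_convex r Q \<Longrightarrow> poly (\<omega> Q) (real n) = real (card (order_maps r Q n))"
    and nn: "\<And>Q. Q \<subseteq> P \<Longrightarrow> order_convex r Q \<Longrightarrow> nonneg_coeffs (\<omega> Q)"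
  shows "ehrhart_positive P (marked_order_polytope P r A l)"
proof (cases "marked_order_polytope P r A l = {}")
  case True
  \<comment> \<open>Even the 0-th dilation of the empty set is empty, whereas
    \<open>marked_maps\<close> at 0 consists of one map; hence the separate case.\<close>
  have "is_ehrhart_polynomial P {} 0"
    by (simp add: is_ehrhart_polynomial_def dilate_def)
  then show ?thesis
    unfolding ehrhart_positive_def using lattice_marked_order_polytope[OF assms(1,5) above below, of l]
    by (auto simp: True intro!: exI[of _ 0])
next
  case False
  then obtain f where f: "f \<in> marked_order_polytope P r A l" by blast
  have finA: "finite A" using assms(1,5) by (rule rev_finite_subset)
  have AP: "A \<inter> P = A" using assms(5) by blast
  \<comment> \<open>Any common lower bound of the marks would do; this one is defined also for empty
    \<open>A\<close>.\<close>
  define c where "c = - (\<Sum>a\<in>A. \<bar>l a\<bar>)"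
  have c: "c \<le> l a" if "a \<in> A" for a
    using member_le_sum[OF that, of "\<lambda>a. \<bar>l a\<bar>"] finA by (auto simp: c_def)
  \<comment> \<open>A point of the polytope witnesses that the marking itself is order
    preserving.\<close>
  have "of_int (l a) \<le> real_of_int (l b)" if "a \<in> A" "b \<in> A" "(a, b) \<in> r" for a b
    using marked_order_polytopeD[OF f] that assms(5) by (metis subsetD)
  then have mono: "nat (l a - c) \<le> nat (l b - c)" if "a \<in> A" "b \<in> A" "(a, b) \<in> r" for a b
    using that by (intro nat_mono) simp
  have "\<exists>E. nonneg_coeffs E \<and>
      (\<forall>n. poly E (real n) = real (card (marked_maps r P A (\<lambda>a. nat (l a - c)) n)))"
  proof (rule marked_maps_poly[OF assms(2) \<omega> nn assms(1,3) order_refl assms(4)])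
    show "nat (l a - c) < Suc (\<Sum>a\<in>A. nat (l a - c))" if "a \<in> A \<inter> P" for a
      using that finA by (auto simp: less_Suc_eq_le intro!: member_le_sum)
  qed (use above mono in \<open>auto simp: AP\<close>)
  then obtain E where E: "nonneg_coeffs E"
    "\<And>n. poly E (real n) = real (card (marked_maps r P A (\<lambda>a. nat (l a - c)) n))"
    by blast
  have dil: "dilate P n (marked_order_polytope P r A l) = marked_order_polytope P r A (\<lambda>a. int n * l a)"
    for n by (rule dilate_marked_order_polytope; use assms(5) above below False in blast)
  have bij: "bij_betw (\<lambda>g. \<lambda>p\<in>P. real (g p) + of_int (int n * c))
      (marked_maps r P A (\<lambda>a. nat (l a - c)) n)
      (dilate P n (marked_order_polytope P r A l) \<inter> (P \<rightarrow>\<^sub>E \<int>))" for n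
    unfolding dil by (rule bij_betw_marked_maps; use assms(5) below c in blast)
  have "finite (marked_maps r P A (\<lambda>a. nat (l a - c)) n)" for n
    using assms(1) above by (intro finite_marked_maps) (auto simp: AP)
  then have "is_ehrhart_polynomial P (marked_order_polytope P r A l) E"
    using bij_betw_finite[OF bij] bij_betw_same_card[OF bij] by (simp add: is_ehrhart_polynomial_def E(2))
  then show ?thesis
    unfolding ehrhart_positive_def
    using lattice_marked_order_polytope[OF assms(1,5) above below] E(1)
    by (auto simp: nonneg_coeffs_def)
qed

section \<open>Kreweras' determinant\<close>

text \<open>The cofactors along column \<open>k\<close> do not see that column, so they can be
  computed with zeros in it. One family \<open>c\<close> then serves every choice of the
  column.\<close>

lemma det_column_linear:
  fixes M :: "nat \<Rightarrow> nat \<Rightarrow> 'a :: comm_ring_1"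
  assumes "k < r"
  obtains c where "\<And>f. det (mat r r (\<lambda>(i, j). if j = k then f i else M i j)) = (\<Sum>i<r. f i * c i)"
proof
  let ?A = "\<lambda>f. mat r r (\<lambda>(i, j). if j = k then f i else M i j)"
  fix f :: "nat \<Rightarrow> 'a"
  have "mat_delete (?A f) i k = mat_delete (?A (\<lambda>_. 0)) i k" if "i < r" for i
    using that assms by (intro eq_matI) (auto simp: mat_delete_def)
  then show "det (?A f) = (\<Sum>i<r. f i * cofactor (?A (\<lambda>_. 0)) i k)"
    using assms by (subst laplace_expansion_column[of _ r k]) (auto simp: cofactor_def)
qed

lemma det_zero_row:
  fixes A :: "'a :: comm_ring_1 mat"
  assumes "A \<in> carrier_mat r r" "k < r" "\<And>j. j < r \<Longrightarrow> A $$ (k, j) = 0"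
  shows "det A = 0"
  using laplace_expansion_row[OF assms(1,2)] assms(3) by simp

lemma det_zero_column:
  fixes A :: "'a :: comm_ring_1 mat"
  assumes "A \<in> carrier_mat r r" "k < r" "\<And>i. i < r \<Longrightarrow> A $$ (i, k) = 0"
  shows "det A = 0"
  using laplace_expansion_column[OF assms(1,2)] assms(3) by simp

text \<open>Pigeonhole: a permutation cannot send the \<open>k + 1\<close> columns up to
  \<open>k\<close> into the \<open>k\<close> rows before row \<open>k\<close>, so each Leibniz term
  has a factor in the zero block.\<close>

lemma det_zero_block:
  fixes A :: "'a :: comm_ring_1 mat"
  assumes A: "A \<in> carrier_mat r r" and k: "k < r"
    and zero: "\<And>i j. k \<le> i \<Longrightarrow> i < r \<Longrightarrow> j \<le> k \<Longrightarrow> A $$ (i, j) = 0"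
  shows "det A = 0"
proof -
  have "(\<Prod>j<r. A $$ (p j, j)) = 0" if p: "p permutes {0..<r}" for p
  proof -
    have "\<not> p ` {..k} \<subseteq> {..<k}"
    proof
      assume "p ` {..k} \<subseteq> {..<k}"
      then have "card (p ` {..k}) \<le> k" using card_mono[of "{..<k}"] by auto
      moreover have "card (p ` {..k}) = Suc k"
        using permutes_inj_on[OF p] by (subst card_image) auto
      ultimately show False by simp
    qed
    then obtain j where j: "j \<le> k" "k \<le> p j"
      by (meson atMost_iff image_subsetI lessThan_iff not_less)
    have "p j < r" using permutes_in_image[OF p, of j] j k by auto
    then have "A $$ (p j, j) = 0" using zero j by blast
    then show ?thesis using j k by (intro prod_zero) auto
  qed
  then show ?thesis by (simp add: det_col[OF A])
qed

section \<open>Generalised binomial coefficients and the recursion for the determinant\<close>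

text \<open>The value 0 at negative lower index makes Pascal's rule hold for all integers
  \<open>k\<close>; a real upper argument keeps the entries polynomial in \<open>x\<close>.\<close>

definition gbin :: "real \<Rightarrow> int \<Rightarrow> real" where
  "gbin x k = (if k < 0 then 0 else x gchoose nat k)"

lemma gbin_Suc: "gbin (x + 1) k = gbin x k + gbin x (k - 1)"
proof (cases "k \<le> 0")
  case False
  then obtain m where m: "k = int (Suc m)"
    by (metis gr0_implies_Suc int_nat_eq not_le zero_less_nat_eq less_imp_le)
  have "nat (int (Suc m) - 1) = m" "nat (int (Suc m)) = Suc m" by simp_all
  then show ?thesis unfolding gbin_def m by (simp add: gbinomial_Suc_Suc del: of_nat_Suc)
qed (auto simp: gbin_def)

lemma gbin_of_nat: "gbin (real m) (int k) = real (m choose k)"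
  by (simp add: gbin_def binomial_gbinomial)

text \<open>For \<open>i = j\<close> and \<open>y = b i\<close> this is the number of multisets of
  size \<open>a i - b i\<close> from \<open>x\<close> values, that is, of monotone fillings of one
  row. The inner boundary \<open>y\<close> is a separate argument so that a single column can be
  summed over it.\<close>

definition kreweras_entry :: "(nat \<Rightarrow> nat) \<Rightarrow> nat \<Rightarrow> nat \<Rightarrow> real \<Rightarrow> nat \<Rightarrow> real" where
  "kreweras_entry a j y x i =
     gbin (x - 1 + real (a i) - real y) (int (a i) - int y - int i + int j)"

text \<open>Used to recognise the upper boundary term of a column sum as the preceding
  column.\<close>

lemma kreweras_entry_shift:
  "kreweras_entry a (Suc j) (Suc y) (x + 1) i = kreweras_entry a j y x i"
  by (simp add: kreweras_entry_def algebra_simps)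

text \<open>Pascal's rule makes the sum telescope: increasing \<open>y\<close> by 1 lowers both
  binomial arguments by 1.\<close>

lemma kreweras_entry_sum:
  assumes "u \<le> v"
  shows "(\<Sum>y=u..<v. kreweras_entry a j y x i) =
    kreweras_entry a j u (x + 1) i - kreweras_entry a j v (x + 1) i"
  using assms
proof (induction v rule: dec_induct)
  case (step v)
  have "kreweras_entry a j v (x + 1) i = kreweras_entry a j v x i + kreweras_entry a j (Suc v) (x + 1) i"
    using gbin_Suc[of "x - 1 + real (a i) - real v" "int (a i) - int v - int i + int j"]
    by (simp add: kreweras_entry_def algebra_simps)
  then show ?case using step by simp
qed simp

definition nonincreasing_below :: "nat \<Rightarrow> (nat \<Rightarrow> nat) \<Rightarrow> bool" where
  "nonincreasing_below r a \<longleftrightarrow> (\<forall>i j. i \<le> j \<longrightarrow> j < r \<longrightarrow> a j \<le> a i)"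

lemma nonincreasing_belowD: "nonincreasing_below r a \<Longrightarrow> i \<le> j \<Longrightarrow> j < r \<Longrightarrow> a j \<le> a i"
  by (auto simp: nonincreasing_below_def)

definition kreweras_mat :: "(nat \<Rightarrow> nat) \<Rightarrow> (nat \<Rightarrow> nat) \<Rightarrow> nat \<Rightarrow> real \<Rightarrow> real mat" where
  "kreweras_mat a b r x = mat r r (\<lambda>(i, j). kreweras_entry a j (b j) x i)"

lemma kreweras_mat_carrier: "kreweras_mat a b r x \<in> carrier_mat r r"
  by (simp add: kreweras_mat_def)

lemma kreweras_mat_index:
  "i < r \<Longrightarrow> j < r \<Longrightarrow> kreweras_mat a b r x $$ (i, j) = kreweras_entry a j (b j) x i"
  by (simp add: kreweras_mat_def)

text \<open>Only \<open>\<nu> 0\<close> is bounded by \<open>a\<close>, so the range of each later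
  \<open>\<nu> j\<close> depends on \<open>\<nu> (j - 1)\<close> alone and the columns can be summed
  one by one. Sequences that exceed \<open>a\<close> further down have determinant 0 by
  \<open>det_kreweras_mat_not_le\<close>.\<close>

definition inner_shapes :: "(nat \<Rightarrow> nat) \<Rightarrow> (nat \<Rightarrow> nat) \<Rightarrow> nat \<Rightarrow> (nat \<Rightarrow> nat) set" where
  "inner_shapes a b k = {\<nu> \<in> {..<k} \<rightarrow>\<^sub>E UNIV.
     nonincreasing_below k \<nu> \<and> (\<forall>j<k. b j \<le> \<nu> j) \<and> (0 < k \<longrightarrow> \<nu> 0 \<le> a 0)}"

lemma finite_inner_shapes: "finite (inner_shapes a b k)"
proof (rule finite_subset)
  show "inner_shapes a b k \<subseteq> {..<k} \<rightarrow>\<^sub>E {..a 0}"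
  proof
    fix \<nu> assume \<nu>: "\<nu> \<in> inner_shapes a b k"
    have "\<nu> j \<le> a 0" if "j < k" for j
    proof -
      have "\<nu> j \<le> \<nu> 0"
        using \<nu> nonincreasing_belowD[of k \<nu> 0 j] that by (simp add: inner_shapes_def)
      also have "\<nu> 0 \<le> a 0" using \<nu> that by (auto simp: inner_shapes_def)
      finally show ?thesis .
    qed
    then show "\<nu> \<in> {..<k} \<rightarrow>\<^sub>E {..a 0}" using \<nu> by (auto simp: inner_shapes_def)
  qed
qed (simp add: finite_PiE)

lemma inner_shapes_Suc:
  "inner_shapes a b (Suc k) = (\<lambda>(\<nu>, y). \<nu>(k := y)) `
     (SIGMA \<nu>:inner_shapes a b k. {b k..if k = 0 then a 0 else \<nu> (k - 1)})"
    (is "_ = ?f ` ?S")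
proof (intro equalityI subsetI)
  fix \<nu> assume \<nu>: "\<nu> \<in> inner_shapes a b (Suc k)"
  have "restrict \<nu> {..<k} \<in> inner_shapes a b k"
    using \<nu> by (auto simp: inner_shapes_def nonincreasing_below_def)
  moreover have "\<nu> k \<in> {b k..if k = 0 then a 0 else restrict \<nu> {..<k} (k - 1)}"
    using \<nu> by (auto simp: inner_shapes_def nonincreasing_below_def)
  moreover have "\<nu> = (restrict \<nu> {..<k})(k := \<nu> k)"
    using \<nu> by (auto simp: inner_shapes_def PiE_iff extensional_def fun_eq_iff)
  ultimately show "\<nu> \<in> ?f ` ?S"
    by (intro image_eqI[of _ _ "(restrict \<nu> {..<k}, \<nu> k)"]) auto
next
  fix \<nu> assume "\<nu> \<in> ?f ` ?S"
  then obtain \<kappa> y where \<kappa>: "\<nu> = \<kappa>(k := y)" "\<kappa> \<in> inner_shapes a b k"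
    "b k \<le> y" "y \<le> (if k = 0 then a 0 else \<kappa> (k - 1))" by auto
  have "\<nu> j \<le> \<nu> i" if "i \<le> j" "j < Suc k" for i j
  proof (cases "j = k \<and> i \<noteq> k")
    case True
    then have "i \<le> k - 1" "k - 1 < k" using that by auto
    then have "\<kappa> (k - 1) \<le> \<kappa> i"
      using \<kappa>(2) by (simp add: inner_shapes_def nonincreasing_below_def)
    then show ?thesis using True \<kappa>(1,4) that by auto
  next
    case False
    then show ?thesis using \<kappa>(1,2) that by (auto simp: inner_shapes_def nonincreasing_below_def)
  qed
  then have "nonincreasing_below (Suc k) \<nu>" by (simp add: nonincreasing_below_def)
  moreover have "\<nu> \<in> {..<Suc k} \<rightarrow>\<^sub>E UNIV"
    using \<kappa>(1,2) by (auto simp: inner_shapes_def PiE_iff extensional_def)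
  ultimately show "\<nu> \<in> inner_shapes a b (Suc k)"
    using \<kappa> by (auto simp: inner_shapes_def less_Suc_eq split: if_splits)
qed

text \<open>The columns are summed from the last to the first. By the hockey-stick identity the upper
  end of each sum contributes a copy of the preceding column, which does not change the
  determinant.\<close>

lemma kreweras_det_step:
  assumes a: "nonincreasing_below r a" and b: "nonincreasing_below r b" and b0: "0 < r \<Longrightarrow> b 0 \<le> a 0"
  shows "(\<Sum>\<nu>\<in>inner_shapes a b r. det (kreweras_mat a \<nu> r x)) = det (kreweras_mat a b r (x + 1))"
proof -
  \<comment> \<open>\<open>N k \<nu>\<close> interpolates between the two sides: columns before
    \<open>k\<close> belong to \<nu> at \<open>x\<close>, the others to \<open>b\<close> at
    \<open>x + 1\<close>.\<close>
  define N where "N = (\<lambda>k \<nu> i j. if j < k then kreweras_entry a j (\<nu> j) x i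
    else kreweras_entry a j (b j) (x + 1) i)"
  let ?D = "\<lambda>k \<nu>. det (mat r r (\<lambda>(i, j). N k \<nu> i j))"
  have step: "(\<Sum>\<nu>\<in>inner_shapes a b (Suc k). ?D (Suc k) \<nu>) = (\<Sum>\<nu>\<in>inner_shapes a b k. ?D k \<nu>)"
    if k: "k < r" for k
  proof -
    let ?u = "\<lambda>\<nu>. if k = 0 then a 0 else \<nu> (k - 1)"
    let ?S = "SIGMA \<nu>:inner_shapes a b k. {b k..?u \<nu>}"
    have inj: "inj_on (\<lambda>(\<nu>, y). \<nu>(k := y)) ?S"
    proof (rule inj_onI, clarify)
      fix \<nu> \<nu>' y y' assume \<nu>: "\<nu> \<in> inner_shapes a b k" "\<nu>' \<in> inner_shapes a b k"
        and eq: "\<nu>(k := y) = \<nu>'(k := y')"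
      have "\<nu> k = \<nu>' k" using \<nu> by (auto simp: inner_shapes_def PiE_iff extensional_def)
      then show "\<nu> = \<nu>' \<and> y = y'" using eq by (metis fun_upd_same fun_upd_triv fun_upd_upd)
    qed
    have inner: "(\<Sum>y\<in>{b k..?u \<nu>}. ?D (Suc k) (\<nu>(k := y))) = ?D k \<nu>" if \<nu>: "\<nu> \<in> inner_shapes a b k" for \<nu>
    proof -
      obtain c where c: "\<And>f. det (mat r r (\<lambda>(i, j). if j = k then f i else N k \<nu> i j)) = (\<Sum>i<r. f i * c i)"
        using det_column_linear[OF k] by blast
      have "b k \<le> Suc (?u \<nu>)"
      proof (cases "k = 0")
        case False
        then have "b k \<le> b (k - 1)" using nonincreasing_belowD[OF b] k by simp
        also have "\<dots> \<le> \<nu> (k - 1)" using \<nu> False by (simp add: inner_shapes_def)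
        finally show ?thesis using False by simp
      qed (use b0 k in auto)
      note sum = kreweras_entry_sum[OF this, of a k x]
      \<comment> \<open>The upper boundary term vanishes. For \<open>k = 0\<close> the bound is
        \<open>Suc (a 0)\<close>, which makes every lower binomial index negative; otherwise the
        term is a determinant with two equal columns.\<close>
      have zero: "(\<Sum>i<r. kreweras_entry a k (Suc (?u \<nu>)) (x + 1) i * c i) = 0"
      proof (cases k)
        case 0
        then have "kreweras_entry a k (Suc (?u \<nu>)) (x + 1) i = 0" if "i < r" for i
          using nonincreasing_belowD[OF a _ that, of 0] by (simp add: kreweras_entry_def gbin_def)
        then show ?thesis by simp
      next
        case (Suc m)
        then have "(\<Sum>i<r. kreweras_entry a k (Suc (?u \<nu>)) (x + 1) i * c i) =
            (\<Sum>i<r. N k \<nu> i m * c i)"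
          by (simp add: kreweras_entry_shift N_def)
        also have "\<dots> = det (mat r r (\<lambda>(i, j). if j = k then N k \<nu> i m else N k \<nu> i j))"
          using c[of "\<lambda>i. N k \<nu> i m"] by simp
        also have "\<dots> = 0"
          using k Suc by (intro det_identical_columns[of _ r m k]) (auto simp: col_def)
        finally show ?thesis .
      qed
      have "?D (Suc k) (\<nu>(k := y)) = (\<Sum>i<r. kreweras_entry a k y x i * c i)" for y
        unfolding c[of "kreweras_entry a k y x", symmetric]
        by (intro arg_cong[of _ _ det] eq_matI) (auto simp: N_def)
      then have "(\<Sum>y\<in>{b k..?u \<nu>}. ?D (Suc k) (\<nu>(k := y))) =
          (\<Sum>y\<in>{b k..?u \<nu>}. \<Sum>i<r. kreweras_entry a k y x i * c i)" by simp
      also have "\<dots> = (\<Sum>i<r. (\<Sum>y=b k..<Suc (?u \<nu>). kreweras_entry a k y x i) * c i)"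
        by (subst sum.swap) (simp only: sum_distrib_right atLeastLessThanSuc_atLeastAtMost)
      also have "\<dots> = (\<Sum>i<r. kreweras_entry a k (b k) (x + 1) i * c i)"
        unfolding sum using zero by (simp add: left_diff_distrib sum_subtractf)
      also have "\<dots> = ?D k \<nu>"
        unfolding c[of "kreweras_entry a k (b k) (x + 1)", symmetric]
        by (intro arg_cong[of _ _ det] eq_matI) (auto simp: N_def)
      finally show ?thesis .
    qed
    have "(\<Sum>\<nu>\<in>inner_shapes a b (Suc k). ?D (Suc k) \<nu>) =
        (\<Sum>(\<nu>, y)\<in>?S. ?D (Suc k) (\<nu>(k := y)))"
      unfolding inner_shapes_Suc by (subst sum.reindex[OF inj]) (simp add: case_prod_unfold)
    also have "\<dots> = (\<Sum>\<nu>\<in>inner_shapes a b k. \<Sum>y\<in>{b k..?u \<nu>}. ?D (Suc k) (\<nu>(k := y)))"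
      by (rule sum.Sigma[symmetric]) (auto simp: finite_inner_shapes)
    finally show ?thesis using inner by simp
  qed
  have "(\<Sum>\<nu>\<in>inner_shapes a b k. ?D k \<nu>) = (\<Sum>\<nu>\<in>inner_shapes a b 0. ?D 0 \<nu>)" if "k \<le> r" for k
    using that by (induction k) (simp_all add: step)
  from this[of r] have "(\<Sum>\<nu>\<in>inner_shapes a b r. ?D r \<nu>) = (\<Sum>\<nu>\<in>inner_shapes a b 0. ?D 0 \<nu>)"
    by simp
  moreover have "inner_shapes a b 0 = {\<lambda>_. undefined}"
    by (auto simp: inner_shapes_def nonincreasing_below_def)
  moreover have "mat r r (\<lambda>(i, j). N r \<nu> i j) = kreweras_mat a \<nu> r x" for \<nu>
    by (intro eq_matI) (auto simp: N_def kreweras_mat_def)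
  moreover have "mat r r (\<lambda>(i, j). N 0 \<nu> i j) = kreweras_mat a b r (x + 1)" for \<nu>
    by (intro eq_matI) (auto simp: N_def kreweras_mat_def)
  ultimately show ?thesis by simp
qed

section \<open>Vanishing and boundary values of the determinant\<close>

lemma kreweras_entry_eq_0:
  "int (a i) + int j < int y + int i \<Longrightarrow> kreweras_entry a j y x i = 0"
  by (simp add: kreweras_entry_def gbin_def)

text \<open>At \<open>x = 0\<close> the upper argument is the natural number
  \<open>a i - y - 1\<close>, and the lower index exceeds it.\<close>

lemma kreweras_entry_0_eq_0:
  assumes "y < a i" "i \<le> j"
  shows "kreweras_entry a j y 0 i = 0"
proof -
  have "kreweras_entry a j y 0 i = gbin (real (a i - y - 1)) (int (a i - y + (j - i)))"
    unfolding kreweras_entry_def using assms by (intro arg_cong2[of _ _ _ _ gbin]) auto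
  also have "\<dots> = 0" unfolding gbin_of_nat using assms by simp
  finally show ?thesis .
qed

text \<open>By monotonicity \<open>a i < b j\<close> for all rows \<open>i\<close> from
  \<open>k\<close> on and all columns \<open>j\<close> up to \<open>k\<close>, so the lower indices
  in that block are negative.\<close>

lemma det_kreweras_mat_not_le:
  assumes "nonincreasing_below r a" "nonincreasing_below r b" "k < r" "a k < b k"
  shows "det (kreweras_mat a b r x) = 0"
proof (rule det_zero_block[OF kreweras_mat_carrier assms(3)])
  fix i j assume "k \<le> i" "i < r" "j \<le> k"
  then have "a i \<le> a k" "b k \<le> b j"
    using assms nonincreasing_belowD by blast+
  then show "kreweras_mat a b r x $$ (i, j) = 0"
    using \<open>k \<le> i\<close> \<open>i < r\<close> \<open>j \<le> k\<close> assms(4)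
    by (simp add: kreweras_mat_index kreweras_entry_eq_0)
qed

text \<open>Below the diagonal the lower index is negative, and on the diagonal it is 0, so the
  matrix is upper unitriangular.\<close>

lemma det_kreweras_mat_0_eq:
  assumes a: "nonincreasing_below r a" and eq: "\<And>i. i < r \<Longrightarrow> b i = a i"
  shows "det (kreweras_mat a b r 0) = 1"
proof -
  have "kreweras_mat a b r 0 $$ (i, j) = 0" if "j < i" "i < r" for i j
    using that nonincreasing_belowD[OF a, of j i] by (simp add: kreweras_mat_index eq kreweras_entry_eq_0)
  then have "upper_triangular (kreweras_mat a b r 0)"
    using kreweras_mat_carrier[of a b r 0] by auto
  then have "det (kreweras_mat a b r 0) = prod_list (diag_mat (kreweras_mat a b r 0))"
    using kreweras_mat_carrier by (rule det_upper_triangular)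
  also have "diag_mat (kreweras_mat a b r 0) = map (\<lambda>_. 1) [0..<r]"
    unfolding diag_mat_def
    by (intro map_cong) (auto simp: kreweras_mat_def kreweras_entry_def gbin_def eq)
  also have "prod_list \<dots> = 1" by (simp add: map_replicate_const)
  finally show ?thesis .
qed

text \<open>The row of the first index \<open>s\<close> with \<open>b s < a s\<close> vanishes: from
  the diagonal on by \<open>kreweras_entry_0_eq_0\<close>, and before it because
  \<open>b j = a j\<close> there makes the lower index negative.\<close>

lemma det_kreweras_mat_0_less:
  assumes a: "nonincreasing_below r a" and b: "nonincreasing_below r b"
    and le: "\<And>i. i < r \<Longrightarrow> b i \<le> a i" and "k < r" "b k < a k"
  shows "det (kreweras_mat a b r 0) = 0"
proof -
  define s where "s = (LEAST i. b i < a i)"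
  have s: "b s < a s" unfolding s_def by (rule LeastI[of "\<lambda>i. b i < a i", OF assms(5)])
  have "s \<le> k" unfolding s_def by (rule Least_le[of "\<lambda>i. b i < a i", OF assms(5)])
  then have sr: "s < r" using assms(4) by simp
  have "kreweras_mat a b r 0 $$ (s, j) = 0" if j: "j < r" for j
  proof (cases "s \<le> j")
    case True
    then have "b j < a s" using nonincreasing_belowD[OF b True j] s by simp
    then show ?thesis using True sr j by (simp add: kreweras_mat_index kreweras_entry_0_eq_0)
  next
    case False
    then have "b j = a j"
      using not_less_Least[of j "\<lambda>i. b i < a i"] le[OF j] by (simp add: s_def)
    moreover have "a s \<le> a j" using nonincreasing_belowD[OF a _ sr] False by simp
    ultimately show ?thesis using False sr j by (simp add: kreweras_mat_index kreweras_entry_eq_0)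
  qed
  then show ?thesis by (rule det_zero_row[OF kreweras_mat_carrier sr])
qed

section \<open>Up-sets of skew shapes and the count of order-preserving maps\<close>

text \<open>The reversed componentwise order, with top-left cells largest as in
  \<open>skew_covers\<close>. It is reflexive and lives on the whole plane, so it restricts to any
  set of cells.\<close>

definition cell_order :: "((nat \<times> nat) \<times> (nat \<times> nat)) set" where
  "cell_order = {(p, q). fst q \<le> fst p \<and> snd q \<le> snd p}"

lemma trans_cell_order: "trans cell_order"
  by (auto simp: cell_order_def trans_def)

text \<open>The row offset \<open>s\<close> lets \<open>a\<close> and \<open>b\<close> be indexed
  from 0 like the rows and columns of the matrix.\<close>

definition shape_cells :: "nat \<Rightarrow> nat \<Rightarrow> (nat \<Rightarrow> nat) \<Rightarrow> (nat \<Rightarrow> nat) \<Rightarrow> (nat \<times> nat) set" where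
  "shape_cells s r a b = {(s + i, j) | i j. i < r \<and> b i \<le> j \<and> j < a i}"

lemma mem_shape_cells: "(s + i, j) \<in> shape_cells s r a b \<longleftrightarrow> i < r \<and> b i \<le> j \<and> j < a i"
  by (auto simp: shape_cells_def)

lemma finite_shape_cells: "finite (shape_cells s r a b)"
proof (rule finite_subset)
  show "shape_cells s r a b \<subseteq> (\<Union>i<r. (\<lambda>j. (s + i, j)) ` {..<a i})"
    by (auto simp: shape_cells_def)
qed auto

lemma shape_cells_diff:
  assumes "\<And>i. i < r \<Longrightarrow> \<nu> i \<le> a i" "\<And>i. i < r \<Longrightarrow> b i \<le> \<nu> i"
  shows "shape_cells s r a b - shape_cells s r \<nu> b = shape_cells s r a \<nu>"
  using assms by (fastforce simp: shape_cells_def)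

lemma nat_set_interval:
  fixes J :: "nat set"
  assumes "finite J" and down: "\<And>i j. j \<in> J \<Longrightarrow> i \<le> j \<Longrightarrow> c \<le> i \<Longrightarrow> i \<in> J" and low: "\<And>j. j \<in> J \<Longrightarrow> c \<le> j"
  shows "J = {c..<c + card J}"
proof -
  have "\<exists>m. J = {c..<m} \<and> c \<le> m"
  proof (cases "J = {}")
    case False
    have "J = {c..<Suc (Max J)}"
      using down[OF Max_in[OF assms(1) False]] low Max_ge[OF assms(1)] by (auto simp: less_Suc_eq_le)
    then show ?thesis using low[OF Max_in[OF assms(1) False]] by (intro exI[of _ "Suc (Max J)"]) simp
  qed auto
  then show ?thesis by auto
qed

text \<open>An up-set is closed under moving left and up inside the shape, so it meets each row in
  an initial segment; \<nu> records where these segments end.\<close>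

lemma up_sets_shape_cells:
  assumes a: "nonincreasing_below r a" and b: "nonincreasing_below r b"
    and le: "\<And>i. i < r \<Longrightarrow> b i \<le> a i"
  shows "bij_betw (\<lambda>\<nu>. shape_cells s r \<nu> b) {\<nu> \<in> inner_shapes a b r. \<forall>i<r. \<nu> i \<le> a i}
    (up_sets cell_order (shape_cells s r a b))"
    (is "bij_betw ?f ?N ?U")
  unfolding bij_betw_def
proof (intro conjI equalityI subsetI)
  show "inj_on ?f ?N"
  proof (rule inj_onI)
    fix \<nu> \<kappa> assume \<nu>: "\<nu> \<in> ?N" and \<kappa>: "\<kappa> \<in> ?N" and eq: "?f \<nu> = ?f \<kappa>"
    have "\<nu> i = \<kappa> i" if i: "i < r" for i
    proof -
      have "b i \<le> j \<and> j < \<nu> i \<longleftrightarrow> b i \<le> j \<and> j < \<kappa> i" for j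
        using eq i mem_shape_cells[of s i j r \<nu> b] mem_shape_cells[of s i j r \<kappa> b] by simp
      then have "{b i..<\<nu> i} = {b i..<\<kappa> i}" by (simp add: set_eq_iff)
      then have "card {b i..<\<nu> i} = card {b i..<\<kappa> i}" by simp
      moreover have "b i \<le> \<nu> i" "b i \<le> \<kappa> i" using \<nu> \<kappa> i by (auto simp: inner_shapes_def)
      ultimately show ?thesis by simp
    qed
    then show "\<nu> = \<kappa>"
      using \<nu> \<kappa> by (intro extensionalityI[of _ "{..<r}"]) (auto simp: inner_shapes_def PiE_iff)
  qed
next
  fix K assume "K \<in> ?f ` ?N"
  then obtain \<nu> where K: "K = ?f \<nu>" and \<nu>: "\<nu> \<in> ?N" by blast
  have "K \<subseteq> shape_cells s r a b"
    using \<nu> by (force simp: K shape_cells_def)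
  moreover have "q \<in> K" if pK: "p \<in> K" and qQ: "q \<in> shape_cells s r a b" and pq: "(p, q) \<in> cell_order" for p q
  proof -
    obtain i j where p: "p = (s + i, j)" "i < r" "b i \<le> j" "j < \<nu> i"
      using pK by (auto simp: K shape_cells_def)
    obtain i' j' where q: "q = (s + i', j')" "i' < r" "b i' \<le> j'" "j' < a i'"
      using qQ by (auto simp: shape_cells_def)
    have le: "i' \<le> i" "j' \<le> j" using pq by (auto simp: p q cell_order_def)
    have "\<nu> i \<le> \<nu> i'" using \<nu> le p by (auto simp: inner_shapes_def intro: nonincreasing_belowD)
    then show ?thesis using le p q by (simp add: K mem_shape_cells)
  qed
  ultimately show "K \<in> ?U" by (auto simp: up_sets_def)
next
  fix K assume K: "K \<in> ?U"
  then have KQ: "K \<subseteq> shape_cells s r a b"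
    and up: "\<And>p q. p \<in> K \<Longrightarrow> q \<in> shape_cells s r a b \<Longrightarrow> (p, q) \<in> cell_order \<Longrightarrow> q \<in> K"
    by (auto simp: up_sets_def)
  define J where "J = (\<lambda>i. {j. (s + i, j) \<in> K})"
  define \<nu> where "\<nu> = (\<lambda>i\<in>{..<r}. b i + card (J i))"
  have JD: "b i \<le> j" "j < a i" "i < r" if "j \<in> J i" for i j
  proof -
    have "(s + i, j) \<in> shape_cells s r a b" using that KQ by (auto simp: J_def)
    then show "b i \<le> j" "j < a i" "i < r" by (simp_all add: mem_shape_cells)
  qed
  have J: "J i = {b i..<\<nu> i}" if i: "i < r" for i
  proof -
    have "J i = {b i..<b i + card (J i)}"
    proof (rule nat_set_interval)
      show "finite (J i)" by (rule finite_subset[of _ "{..<a i}"]) (auto dest: JD)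
      fix k j assume "j \<in> J i" "k \<le> j" "b i \<le> k"
      then show "k \<in> J i"
        unfolding J_def using JD[OF \<open>j \<in> J i\<close>]
        by (auto simp: J_def mem_shape_cells cell_order_def intro!: up[of "(s + i, j)"])
    qed (use JD in blast)
    then show ?thesis using i by (simp add: \<nu>_def)
  qed
  have \<nu>_ext: "\<nu> \<in> extensional {..<r}" by (simp add: \<nu>_def)
  have b\<nu>: "b i \<le> \<nu> i" if "i < r" for i using that by (simp add: \<nu>_def)
  have \<nu>a: "\<nu> i \<le> a i" if i: "i < r" for i
  proof (cases "b i = \<nu> i")
    case False
    then have "\<nu> i - 1 \<in> J i" using b\<nu>[OF i] by (auto simp: J[OF i])
    then show ?thesis using JD[of "\<nu> i - 1" i] by simp
  qed (use le[OF i] in simp)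
  \<comment> \<open>If row \<open>j\<close> reached further than the higher row \<open>i\<close>,
    its last cell moved up to row \<open>i\<close> would still lie in the shape, hence in
    \<open>K\<close>.\<close>
  have "\<nu> j \<le> \<nu> i" if ij: "i \<le> j" "j < r" for i j
  proof (rule ccontr)
    assume neg: "\<not> \<nu> j \<le> \<nu> i"
    have ir: "i < r" using ij by simp
    have "b j \<le> b i" "a j \<le> a i" using nonincreasing_belowD[OF b ij] nonincreasing_belowD[OF a ij] .
    then have "\<nu> j - 1 \<in> J j" using neg b\<nu>[OF ir] by (auto simp: J[OF ij(2)])
    moreover have "(s + i, \<nu> j - 1) \<in> shape_cells s r a b"
      using neg b\<nu>[OF ir] \<nu>a[OF ij(2)] \<open>a j \<le> a i\<close> ir by (auto simp: mem_shape_cells)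
    ultimately have "\<nu> j - 1 \<in> J i"
      using up[of "(s + j, \<nu> j - 1)" "(s + i, \<nu> j - 1)"] ij by (simp add: J_def cell_order_def)
    then show False using neg by (auto simp: J[OF ir])
  qed
  then have "\<nu> \<in> ?N"
    using b\<nu> \<nu>a le by (auto simp: inner_shapes_def nonincreasing_below_def PiE_iff \<nu>_ext)
  moreover have "K = ?f \<nu>"
  proof (intro equalityI subsetI)
    fix x assume "x \<in> K"
    then obtain i j where x: "x = (s + i, j)" "i < r" using KQ by (auto simp: shape_cells_def)
    then have "j \<in> J i" using \<open>x \<in> K\<close> by (simp add: J_def)
    then show "x \<in> ?f \<nu>" using x by (simp add: J mem_shape_cells)
  next
    fix x assume "x \<in> ?f \<nu>"
    then obtain i j where x: "x = (s + i, j)" "i < r" "b i \<le> j" "j < \<nu> i"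
      by (auto simp: shape_cells_def)
    then have "j \<in> J i" by (simp add: J)
    then show "x \<in> K" using x by (simp add: J_def)
  qed
  ultimately show "K \<in> ?f ` ?N" by blast
qed

text \<open>Induction on \<open>n\<close> with varying inner boundary: the cells carrying the top
  value form an up-set bounded by some \<nu>, and the rest is the shape between \<nu> and
  \<open>a\<close>. The determinant obeys the same recursion by
  \<open>kreweras_det_step\<close>.\<close>

lemma kreweras:
  assumes a: "nonincreasing_below r a" and b: "nonincreasing_below r b"
    and le: "\<And>i. i < r \<Longrightarrow> b i \<le> a i"
  shows "det (kreweras_mat a b r (real n)) = real (card (order_maps cell_order (shape_cells s r a b) n))"
  using b le
proof (induction n arbitrary: b)
  case 0
  note b = 0(1) and le = 0(2)
  show ?case
  proof (cases "shape_cells s r a b = {}")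
    case True
    have "b i = a i" if "i < r" for i
    proof (rule ccontr)
      assume "b i \<noteq> a i"
      then have "(s + i, b i) \<in> shape_cells s r a b" using le[OF that] that by (simp add: mem_shape_cells)
      with True show False by simp
    qed
    then show ?thesis using det_kreweras_mat_0_eq[OF a] True by (simp add: order_maps_empty)
  next
    case False
    then obtain i where "i < r" "b i < a i" by (force simp: shape_cells_def)
    then show ?thesis
      using det_kreweras_mat_0_less[OF a b le] False by (simp add: order_maps_zero)
  qed
next
  case (Suc n)
  note b = Suc.prems(1) and le = Suc.prems(2)
  let ?Q = "shape_cells s r a b"
  let ?N = "{\<nu> \<in> inner_shapes a b r. \<forall>i<r. \<nu> i \<le> a i}"
  have "card (order_maps cell_order ?Q (Suc n)) =
      (\<Sum>K\<in>up_sets cell_order ?Q. card (order_maps cell_order (?Q - K) n))"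
    using card_order_maps_add[OF finite_shape_cells, of cell_order s r a b n 1]
    by (simp add: order_maps_one[unfolded One_nat_def])
  also have "\<dots> = (\<Sum>\<nu>\<in>?N. card (order_maps cell_order (?Q - shape_cells s r \<nu> b) n))"
    by (rule sum.reindex_bij_betw[OF up_sets_shape_cells[OF a b le], symmetric])
  also have "\<dots> = (\<Sum>\<nu>\<in>?N. card (order_maps cell_order (shape_cells s r a \<nu>) n))"
    by (intro sum.cong arg_cong[of _ _ "\<lambda>Q. card (order_maps cell_order Q n)"] shape_cells_diff)
      (auto simp: inner_shapes_def)
  finally have "real (card (order_maps cell_order ?Q (Suc n))) =
      (\<Sum>\<nu>\<in>?N. real (card (order_maps cell_order (shape_cells s r a \<nu>) n)))"
    by simp
  also have "\<dots> = (\<Sum>\<nu>\<in>?N. det (kreweras_mat a \<nu> r (real n)))"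
    by (intro sum.cong refl Suc.IH[symmetric]) (auto simp: inner_shapes_def)
  \<comment> \<open>Sequences leaving the outer boundary are added back with determinant 0 to match
    the column recursion.\<close>
  also have "\<dots> = (\<Sum>\<nu>\<in>inner_shapes a b r. det (kreweras_mat a \<nu> r (real n)))"
  proof (rule sum.mono_neutral_left)
    show "\<forall>\<nu>\<in>inner_shapes a b r - ?N. det (kreweras_mat a \<nu> r (real n)) = 0"
    proof
      fix \<nu> assume "\<nu> \<in> inner_shapes a b r - ?N"
      then obtain k where "nonincreasing_below r \<nu>" "k < r" "a k < \<nu> k"
        by (auto simp: inner_shapes_def not_le)
      then show "det (kreweras_mat a \<nu> r (real n)) = 0"
        using det_kreweras_mat_not_le[OF a] by blast
    qed
  qed (auto simp: finite_inner_shapes)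
  also have "\<dots> = det (kreweras_mat a b r (real n + 1))"
    using kreweras_det_step[OF a b] le by simp
  finally show ?case by (simp add: add.commute)
qed

section \<open>The linear coefficient\<close>

definition gbin_poly :: "real \<Rightarrow> int \<Rightarrow> real poly" where
  "gbin_poly c k = (if k < 0 then 0 else Polynomial.smult (1 / fact (nat k)) (\<Prod>t<nat k. [:c - real t, 1:]))"

lemma poly_gbin_poly: "poly (gbin_poly c k) x = gbin (x + c) k"
  by (simp add: gbin_poly_def gbin_def gbinomial_prod_rev poly_prod atLeast0LessThan algebra_simps)

text \<open>The factor with \<open>t = e\<close> is the variable itself, so the linear coefficient
  is the product of the other constant terms, \<open>e\<close> positive and \<open>m\<close>
  negative ones, over the factorial. Its absolute value is
  \<open>e! m! / (e + m + 1)!\<close>.\<close>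

lemma coeff_gbin_poly_sign: "0 \<le> (-1) ^ m * coeff (gbin_poly (real e) (int (e + 1 + m))) 1"
proof -
  let ?q = "\<lambda>T. \<Prod>t\<in>T. [:real e - real t, 1:]"
  have split: "{..<e + 1 + m} = {..<e} \<union> ({e} \<union> {e + 1..<e + 1 + m})" by auto
  have "?q {..<e + 1 + m} = ?q {..<e} * ([:0, 1:] * ?q {e + 1..<e + 1 + m})"
    unfolding split by (subst prod.union_disjoint; (subst prod.union_disjoint)?) auto
  also have "\<dots> = pCons 0 (?q {..<e} * ?q {e + 1..<e + 1 + m})"
    by simp
  finally have "coeff (?q {..<e + 1 + m}) 1 = coeff (?q {..<e} * ?q {e + 1..<e + 1 + m}) 0"
    by (metis One_nat_def coeff_pCons_Suc)
  also have "\<dots> = (\<Prod>t<e. real e - real t) * (\<Prod>t=e + 1..<e + 1 + m. real e - real t)"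
    by (simp add: poly_prod flip: poly_0_coeff_0)
  also have "(\<Prod>t=e + 1..<e + 1 + m. real e - real t) =
      (\<Prod>t=e + 1..<e + 1 + m. (-1) * (real t - real e))" by simp
  also have "\<dots> = (-1) ^ m * (\<Prod>t=e + 1..<e + 1 + m. real t - real e)"
    by (subst prod.distrib) simp
  finally have prod: "coeff (?q {..<e + 1 + m}) 1 = (\<Prod>t<e. real e - real t) *
      ((-1) ^ m * (\<Prod>t=e + 1..<e + 1 + m. real t - real e))" .
  have "gbin_poly (real e) (int (e + 1 + m)) =
      Polynomial.smult (1 / fact (e + 1 + m)) (?q {..<e + 1 + m})"
    unfolding gbin_poly_def nat_int by (simp only: of_nat_less_0_iff if_False)
  then have "(-1) ^ m * coeff (gbin_poly (real e) (int (e + 1 + m))) 1 =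
      1 / fact (e + 1 + m) * ((-1) ^ m * (-1) ^ m) *
      ((\<Prod>t<e. real e - real t) * (\<Prod>t=e + 1..<e + 1 + m. real t - real e))"
    by (simp only: coeff_smult prod mult_ac)
  also have "((-1) ^ m * (-1) ^ m :: real) = 1" by (simp flip: power_add)
  also have "0 \<le> 1 / fact (e + 1 + m) * 1 *
      ((\<Prod>t<e. real e - real t) * (\<Prod>t=e + 1..<e + 1 + m. real t - real e))"
    by (intro mult_nonneg_nonneg prod_nonneg) auto
  finally show ?thesis .
qed

definition kreweras_poly_mat :: "(nat \<Rightarrow> nat) \<Rightarrow> (nat \<Rightarrow> nat) \<Rightarrow> nat \<Rightarrow> real poly mat" where
  "kreweras_poly_mat a b r = mat r r (\<lambda>(i, j).
     gbin_poly (real (a i) - real (b j) - 1) (int (a i) - int (b j) - int i + int j))"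

lemma comm_ring_hom_poly: "comm_ring_hom (\<lambda>p. poly p (x :: 'a :: comm_ring_1))"
  by unfold_locales auto

lemma map_kreweras_poly_mat: "map_mat (\<lambda>p. poly p x) (kreweras_poly_mat a b r) = kreweras_mat a b r x"
  by (intro eq_matI)
    (auto simp: kreweras_poly_mat_def kreweras_mat_def poly_gbin_poly kreweras_entry_def algebra_simps)

lemma poly_det: "poly (det A) x = det (map_mat (\<lambda>p. poly p x) A)"
  by (rule comm_ring_hom.hom_det[OF comm_ring_hom_poly, symmetric])

text \<open>The constant terms of the first row vanish, so the linear coefficient is the Laplace
  expansion along that row in which the cofactors are evaluated at \<open>0\<close>.\<close>

lemma coeff_det_kreweras_poly_mat:
  assumes b: "nonincreasing_below r b" and r: "0 < r" and ne: "b 0 < a 0"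
  shows "coeff (det (kreweras_poly_mat a b r)) 1 =
    (\<Sum>j<r. coeff (kreweras_poly_mat a b r $$ (0, j)) 1 * cofactor (kreweras_mat a b r 0) 0 j)"
proof -
  let ?A = "kreweras_poly_mat a b r"
  have A: "?A \<in> carrier_mat r r" by (simp add: kreweras_poly_mat_def)
  have "coeff (?A $$ (0, j) * cofactor ?A 0 j) 1 =
      coeff (?A $$ (0, j)) 1 * cofactor (kreweras_mat a b r 0) 0 j" if j: "j < r" for j
  proof -
    have "coeff (?A $$ (0, j)) 0 = poly (?A $$ (0, j)) 0" by (simp add: poly_0_coeff_0)
    also have "\<dots> = map_mat (\<lambda>p. poly p 0) ?A $$ (0, j)" using A j r by simp
    also have "\<dots> = kreweras_entry a j (b j) 0 0"
      using j r by (simp add: map_kreweras_poly_mat kreweras_mat_index)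
    also have "\<dots> = 0"
      using nonincreasing_belowD[OF b, of 0 j] j ne by (intro kreweras_entry_0_eq_0) auto
    finally have 0: "coeff (?A $$ (0, j)) 0 = 0" .
    have "map_mat (\<lambda>p. poly p 0) (mat_delete ?A 0 j) = mat_delete (map_mat (\<lambda>p. poly p 0) ?A) 0 j"
      using A j r by (intro eq_matI) (auto simp: mat_delete_def)
    then have "poly (cofactor ?A 0 j) 0 = cofactor (kreweras_mat a b r 0) 0 j"
      by (simp add: cofactor_def poly_det map_kreweras_poly_mat poly_power)
    then show ?thesis using 0 by (simp add: coeff_mult poly_0_coeff_0)
  qed
  then show ?thesis
    using laplace_expansion_row[OF A r] by (simp add: coeff_sum)
qed

lemma mat_delete_0_index:
  assumes "i < m" "k < m"
  shows "mat_delete (kreweras_mat a b (Suc m) x) 0 j $$ (i, k) =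
    kreweras_entry a (if k < j then k else Suc k) (b (if k < j then k else Suc k)) x (Suc i)"
  using assms by (auto simp: mat_delete_def kreweras_mat_def)

lemma mat_delete_0_carrier: "mat_delete (kreweras_mat a b (Suc m) x) 0 j \<in> carrier_mat m m"
  by (simp add: mat_delete_def kreweras_mat_def)

text \<open>\<open>con\<close> says that consecutive rows share a column. Deleting the first row and
  a column \<open>j < m\<close> leaves a zero last column; deleting column \<open>m\<close> leaves a
  lower unitriangular matrix. The surviving cofactor \<open>(-1) ^ m\<close> cancels the sign of the
  corner entry's linear coefficient.\<close>

lemma linear_coeff_connected:
  assumes b: "nonincreasing_below (Suc m) b" and ne: "b 0 < a 0" and con: "\<And>i. i < m \<Longrightarrow> b i < a (Suc i)"
  shows "0 \<le> coeff (det (kreweras_poly_mat a b (Suc m))) 1"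
proof -
  let ?M = "kreweras_mat a b (Suc m) 0"
  have zero: "cofactor ?M 0 j = 0" if "j < m" for j
  proof -
    have "mat_delete ?M 0 j $$ (i, m - 1) = 0" if i: "i < m" for i
    proof -
      have "b m \<le> b i" using nonincreasing_belowD[OF b, of i m] i by simp
      then have "b m < a (Suc i)" using con[OF i] by simp
      then show ?thesis using i \<open>j < m\<close>
        by (simp add: mat_delete_0_index kreweras_entry_0_eq_0)
    qed
    then have "det (mat_delete ?M 0 j) = 0"
      using that by (intro det_zero_column[OF mat_delete_0_carrier, of "m - 1"]) auto
    then show ?thesis by (simp add: cofactor_def)
  qed
  have "det (mat_delete ?M 0 m) = prod_list (diag_mat (mat_delete ?M 0 m))"
  proof (rule det_lower_triangular[OF _ mat_delete_0_carrier])
    fix i j assume ij: "i < j" "j < m"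
    have "b j \<le> b i" using nonincreasing_belowD[OF b, of i j] ij by simp
    then have "b j < a (Suc i)" using con[of i] ij by simp
    then show "mat_delete ?M 0 m $$ (i, j) = 0"
      using ij by (simp add: mat_delete_0_index kreweras_entry_0_eq_0)
  qed
  also have "diag_mat (mat_delete ?M 0 m) = map (\<lambda>_. 1) [0..<m]"
  proof -
    have "mat_delete ?M 0 m $$ (i, i) = 1" if i: "i < m" for i
    proof -
      have "kreweras_entry a i (b i) 0 (Suc i) = gbin (real (a (Suc i) - b i - 1)) (int (a (Suc i) - b i - 1))"
        unfolding kreweras_entry_def using con[OF i] by (intro arg_cong2[of _ _ _ _ gbin]) auto
      then show ?thesis using i by (simp add: mat_delete_0_index gbin_of_nat)
    qed
    moreover have "dim_row (mat_delete ?M 0 m) = m" using mat_delete_0_carrier[of a b m 0 m] by blast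
    ultimately show ?thesis unfolding diag_mat_def by (intro map_cong) auto
  qed
  also have "prod_list \<dots> = 1" by (simp add: map_replicate_const)
  finally have last: "cofactor ?M 0 m = (-1) ^ m" by (simp add: cofactor_def)
  have bm: "b m < a 0" using nonincreasing_belowD[OF b, of 0 m] ne by simp
  \<comment> \<open>\<open>e + 1\<close> is the number of columns of the shape and
    \<open>m + 1\<close> its number of rows.\<close>
  define e where "e = a 0 - b m - 1"
  have "kreweras_poly_mat a b (Suc m) $$ (0, m) = gbin_poly (real e) (int (e + 1 + m))"
  proof -
    have e: "real (a 0) - real (b m) - 1 = real e" "int (a 0) - int (b m) - int 0 + int m = int (e + 1 + m)"
      using bm by (auto simp: e_def)
    have "kreweras_poly_mat a b (Suc m) $$ (0, m) =
        gbin_poly (real (a 0) - real (b m) - 1) (int (a 0) - int (b m) - int 0 + int m)"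
      by (simp add: kreweras_poly_mat_def)
    then show ?thesis unfolding e .
  qed
  then have "coeff (det (kreweras_poly_mat a b (Suc m))) 1 =
      coeff (gbin_poly (real e) (int (e + 1 + m))) 1 * (-1) ^ m"
    using zero last by (subst coeff_det_kreweras_poly_mat[where r = "Suc m" and a = a and b = b, OF b _ ne]) auto
  then show ?thesis using coeff_gbin_poly_sign[of m e] by (simp add: mult.commute)
qed

text \<open>At \<open>x = 0\<close> the row \<open>Suc i\<close> vanishes: up to column
  \<open>i\<close> the lower indices are negative because of the break, and from there on the
  nonempty row makes them exceed the upper arguments. This row occurs in every minor of the
  expansion along row 0.\<close>

lemma linear_coeff_disconnected:
  assumes b: "nonincreasing_below (Suc m) b" and ne: "b 0 < a 0"
    and i: "i < m" "a (Suc i) \<le> b i" "b (Suc i) < a (Suc i)"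
  shows "coeff (det (kreweras_poly_mat a b (Suc m))) 1 = 0"
proof -
  let ?M = "kreweras_mat a b (Suc m) 0"
  have entry: "kreweras_entry a j (b j) 0 (Suc i) = 0" if "j < Suc m" for j
  proof (cases "Suc i \<le> j")
    case True
    then have "b j < a (Suc i)" using nonincreasing_belowD[OF b True that] i(3) by simp
    then show ?thesis using True by (rule kreweras_entry_0_eq_0)
  next
    case False
    then have "a (Suc i) \<le> b j" using nonincreasing_belowD[OF b, of j i] i by simp
    then show ?thesis using False by (intro kreweras_entry_eq_0) simp
  qed
  have "cofactor ?M 0 j = 0" if "j < Suc m" for j
  proof -
    have "det (mat_delete ?M 0 j) = 0"
      using i(1) entry by (intro det_zero_row[OF mat_delete_0_carrier, of i]) (auto simp: mat_delete_0_index)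
    then show ?thesis by (simp add: cofactor_def)
  qed
  then show ?thesis
    by (subst coeff_det_kreweras_poly_mat[where r = "Suc m" and a = a and b = b, OF b _ ne]) auto
qed

text \<open>A break may be followed by empty rows, while \<open>linear_coeff_disconnected\<close>
  wants it just before a nonempty row. So \<open>k\<close> is the next nonempty row after the break
  at \<open>i\<close>; row \<open>k - 1\<close> is then \<open>i\<close> or empty, and the break
  persists there.\<close>

lemma linear_coeff_nonneg:
  assumes a: "nonincreasing_below (Suc m) a" and b: "nonincreasing_below (Suc m) b"
    and le: "\<And>i. i < Suc m \<Longrightarrow> b i \<le> a i" and ne: "b 0 < a 0" "b m < a m"
  shows "0 \<le> coeff (det (kreweras_poly_mat a b (Suc m))) 1"
proof (cases "\<forall>i<m. b i < a (Suc i)")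
  case True
  then show ?thesis by (intro linear_coeff_connected b ne) auto
next
  case False
  then obtain i where i: "i < m" "a (Suc i) \<le> b i" by (auto simp: not_less)
  define k where "k = (LEAST k. i < k \<and> b k < a k)"
  have ex: "i < m \<and> b m < a m" using i ne by simp
  have k: "i < k" "b k < a k" using LeastI[of "\<lambda>k. i < k \<and> b k < a k", OF ex] by (auto simp: k_def)
  have km: "k \<le> m" unfolding k_def using ex by (rule Least_le)
  have "a k \<le> b (k - 1)"
  proof (cases "k = Suc i")
    case False
    then have "\<not> b (k - 1) < a (k - 1)"
      using not_less_Least[of "k - 1" "\<lambda>k. i < k \<and> b k < a k"] k by (auto simp: k_def[symmetric])
    moreover have "a k \<le> a (k - 1)" using nonincreasing_belowD[OF a, of "k - 1" k] km by simp
    ultimately show ?thesis by simp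
  qed (use i in simp)
  then show ?thesis
    using linear_coeff_disconnected[where a = a and b = b and i = "k - 1", OF b ne(1)] k km by simp
qed

section \<open>Skew shapes\<close>

text \<open>\<open>D\<close> consists of all cells weakly above and to the left of some cell of
  \<open>Q\<close>. Both \<open>D\<close> and, by convexity, \<open>D - Q\<close> are closed under
  decreasing coordinates, so their row lengths \<open>a\<close> and \<open>b\<close> are
  nonincreasing. Starting and ending at nonempty rows gives the form that
  \<open>linear_coeff_nonneg\<close> expects.\<close>

lemma order_convex_shape_cells:
  assumes fin: "finite Q" and "Q \<noteq> {}" and conv: "order_convex cell_order Q"
  obtains s m a b where "nonincreasing_below (Suc m) a" "nonincreasing_below (Suc m) b"
    "\<And>i. b i \<le> a i" "b 0 < a 0" "b m < a m" "Q = shape_cells s (Suc m) a b"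
proof -
  define s where "s = Min (fst ` Q)"
  define m where "m = Max (fst ` Q) - s"
  define D where "D = {x. \<exists>q\<in>Q. fst x \<le> fst q \<and> snd x \<le> snd q}"
  define a where "a = (\<lambda>i. card {j. (s + i, j) \<in> D})"
  define b where "b = (\<lambda>i. card {j. (s + i, j) \<in> D - Q})"
  have QD: "Q \<subseteq> D" by (auto simp: D_def)
  have D_down: "y \<in> D" if "x \<in> D" "fst y \<le> fst x" "snd y \<le> snd x" for x y
    using that by (auto simp: D_def intro: le_trans)
  have DQ_down: "y \<in> D - Q" if x: "x \<in> D - Q" and le: "fst y \<le> fst x" "snd y \<le> snd x" for x y
  proof -
    obtain q where q: "q \<in> Q" "fst x \<le> fst q" "snd x \<le> snd q" using x by (auto simp: D_def)
    \<comment> \<open>Otherwise \<open>x\<close> would lie between the elements \<open>q\<close> and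
      \<open>y\<close> of the convex set \<open>Q\<close>.\<close>
    have "y \<notin> Q"
    proof
      assume "y \<in> Q"
      moreover have "(q, x) \<in> cell_order" "(x, y) \<in> cell_order" using q le by (auto simp: cell_order_def)
      ultimately show False using conv q(1) x unfolding order_convex_def by blast
    qed
    then show ?thesis using D_down[of x y] x le by simp
  qed
  have finD: "finite {j. (s + i, j) \<in> D}" for i
  proof (rule finite_subset)
    show "{j. (s + i, j) \<in> D} \<subseteq> (\<Union>q\<in>Q. {..snd q})" by (auto simp: D_def)
  qed (use fin in auto)
  have finDQ: "finite {j. (s + i, j) \<in> D - Q}" for i
    by (rule finite_subset[OF _ finD[of i]]) auto
  have rowD: "(s + i, j) \<in> D \<longleftrightarrow> j < a i" for i j
  proof -
    have "{j. (s + i, j) \<in> D} = {0..<0 + a i}"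
      unfolding a_def by (rule nat_set_interval[OF finD]) (auto intro: D_down)
    then show ?thesis by (auto simp: set_eq_iff)
  qed
  have rowDQ: "(s + i, j) \<in> D - Q \<longleftrightarrow> j < b i" for i j
  proof -
    have "{j. (s + i, j) \<in> D - Q} = {0..<0 + b i}"
      unfolding b_def
    proof (rule nat_set_interval[OF finDQ])
      fix k j assume "j \<in> {j. (s + i, j) \<in> D - Q}" "k \<le> j"
      then show "k \<in> {j. (s + i, j) \<in> D - Q}"
        using DQ_down[of "(s + i, j)" "(s + i, k)"] by simp
    qed simp
    then show ?thesis by (auto simp: set_eq_iff)
  qed
  have rowQ: "(s + i, j) \<in> Q \<longleftrightarrow> b i \<le> j \<and> j < a i" for i j
    using rowD[of i j] rowDQ[of i j] QD by auto
  have a_dec: "nonincreasing_below (Suc m) a"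
    unfolding nonincreasing_below_def
  proof (intro allI impI)
    fix i j :: nat assume "i \<le> j"
    then have "(s + i, k) \<in> D" if "(s + j, k) \<in> D" for k
      using D_down[OF that, of "(s + i, k)"] by simp
    then have "{k. (s + j, k) \<in> D} \<subseteq> {k. (s + i, k) \<in> D}" by blast
    then show "a j \<le> a i" unfolding a_def by (rule card_mono[OF finD])
  qed
  have b_dec: "nonincreasing_below (Suc m) b"
    unfolding nonincreasing_below_def
  proof (intro allI impI)
    fix i j :: nat assume "i \<le> j"
    then have "(s + i, k) \<in> D - Q" if "(s + j, k) \<in> D - Q" for k
      using DQ_down[OF that, of "(s + i, k)"] by simp
    then have "{k. (s + j, k) \<in> D - Q} \<subseteq> {k. (s + i, k) \<in> D - Q}" by blast
    then show "b j \<le> b i" unfolding b_def by (rule card_mono[OF finDQ])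
  qed
  have le: "b i \<le> a i" for i
    unfolding a_def b_def by (intro card_mono finD) auto
  have nonempty_row: "b i < a i" if row: "s + i \<in> fst ` Q" for i
  proof -
    obtain q where "q \<in> Q" "s + i = fst q" using row by blast
    then have "(s + i, snd q) \<in> Q" by simp
    then show ?thesis using rowQ[of i "snd q"] by simp
  qed
  have s: "s \<in> fst ` Q" unfolding s_def using fin \<open>Q \<noteq> {}\<close> by (intro Min_in) auto
  have sm: "s + m = Max (fst ` Q)"
    using Max_ge[OF finite_imageI[OF fin] s] by (simp add: m_def)
  have ne0: "b 0 < a 0" using nonempty_row[of 0] s by simp
  have nem: "b m < a m"
    using fin \<open>Q \<noteq> {}\<close> by (intro nonempty_row, unfold sm, intro Max_in) auto
  have "Q = shape_cells s (Suc m) a b"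
  proof (intro equalityI subsetI)
    fix q assume q: "q \<in> Q"
    have "s \<le> fst q" unfolding s_def using fin q by (intro Min_le) auto
    moreover have "fst q \<le> s + m" unfolding sm using fin q by (intro Max_ge) auto
    ultimately obtain i where i: "fst q = s + i" "i < Suc m"
      by (metis le_Suc_ex nat_add_left_cancel_le less_Suc_eq_le)
    then have "(s + i, snd q) \<in> Q" using q by (metis prod.collapse)
    then have "(s + i, snd q) \<in> shape_cells s (Suc m) a b"
      using i(2) by (simp add: rowQ mem_shape_cells)
    then show "q \<in> shape_cells s (Suc m) a b" using i(1) by (metis prod.collapse)
  qed (auto simp: shape_cells_def rowQ)
  then show ?thesis by (rule that[OF a_dec b_dec le ne0 nem])
qed

lemma order_polynomial_exists:
  assumes "finite Q" "order_convex cell_order Q"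
  shows "\<exists>w. (\<forall>n. poly w (real n) = real (card (order_maps cell_order Q n))) \<and> 0 \<le> coeff w 1"
proof (cases "Q = {}")
  case True
  then show ?thesis by (intro exI[of _ 1]) (simp add: order_maps_empty)
next
  case False
  obtain s m a b where *: "nonincreasing_below (Suc m) a" "nonincreasing_below (Suc m) b"
    "\<And>i. b i \<le> a i" "b 0 < a 0" "b m < a m" "Q = shape_cells s (Suc m) a b"
    by (rule order_convex_shape_cells[OF assms(1) False assms(2)]) (rule that)
  have "poly (det (kreweras_poly_mat a b (Suc m))) (real n) =
      real (card (order_maps cell_order Q n))" for n
    unfolding poly_det map_kreweras_poly_mat *(6) by (rule kreweras[OF *(1,2)]) (rule *(3))
  moreover have "0 \<le> coeff (det (kreweras_poly_mat a b (Suc m))) 1"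
    using * by (intro linear_coeff_nonneg)
  ultimately show ?thesis by blast
qed

section \<open>The order of a skew shape as the restricted componentwise order\<close>

lemma is_partitionD:
  assumes "is_partition lam" "1 \<le> i" "i \<le> j"
  shows "lam j \<le> lam i"
  using assms(3)
proof (induction j rule: dec_induct)
  case (step n)
  then have "lam (Suc n) \<le> lam n" using assms(1,2) by (auto simp: is_partition_def)
  then show ?case using step by simp
qed simp_all

lemma finite_skew_cells:
  assumes "skew_shape lam mu"
  shows "finite (skew_cells lam mu)"
proof (rule finite_subset)
  show "skew_cells lam mu \<subseteq> (SIGMA i:{i. 1 \<le> i \<and> lam i \<noteq> 0}. {..lam i})"
    by (auto simp: skew_cells_def)
qed (use assms in \<open>auto simp: skew_shape_def is_partition_def\<close>)

lemma order_convex_skew_cells: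
  assumes "skew_shape lam mu"
  shows "order_convex cell_order (skew_cells lam mu)"
proof -
  have *: "(i, j) \<in> skew_cells lam mu"
    if "(i0, j0) \<in> skew_cells lam mu" "(i1, j1) \<in> skew_cells lam mu" "i1 \<le> i" "i \<le> i0" "j1 \<le> j" "j \<le> j0"
    for i j i0 j0 i1 j1
    using that assms is_partitionD[of lam i i0] is_partitionD[of mu i1 i]
    by (auto simp: skew_cells_def skew_shape_def)
  have "q \<in> skew_cells lam mu"
    if "p \<in> skew_cells lam mu" "t \<in> skew_cells lam mu" "(p, q) \<in> cell_order" "(q, t) \<in> cell_order"
    for p q t
    using that *[of "fst p" "snd p" "fst t" "snd t" "fst q" "snd q"] by (simp add: cell_order_def)
  then show ?thesis unfolding order_convex_def by blast
qed

lemma skew_lessD: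
  assumes "(p, q) \<in> skew_less lam mu"
  shows "(p, q) \<in> cell_order" "fst q + snd q < fst p + snd p"
proof -
  have "(p, q) \<in> cell_order \<and> fst q + snd q < fst p + snd p"
    using assms unfolding skew_less_def
    by (induction rule: trancl_induct) (auto simp: skew_covers_def cell_order_def)
  then show "(p, q) \<in> cell_order" "fst q + snd q < fst p + snd p" by auto
qed

text \<open>One unit step from \<open>p\<close> towards \<open>q\<close> stays between the two,
  hence in the shape by convexity, and lowers the coordinate sum.\<close>

lemma skew_lessI:
  assumes shape: "skew_shape lam mu" and "p \<in> skew_cells lam mu" "q \<in> skew_cells lam mu"
    and "(p, q) \<in> cell_order" "p \<noteq> q"
  shows "(p, q) \<in> skew_less lam mu"
proof -
  have "(p, q) \<in> (skew_covers lam mu)\<^sup>*"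
    using assms(2,4)
  proof (induction "fst p + snd p" arbitrary: p rule: less_induct)
    case less
    obtain i j i' j' where pq: "p = (i, j)" "q = (i', j')" by (cases p, cases q)
    have le: "i' \<le> i" "j' \<le> j" using less.prems by (auto simp: pq cell_order_def)
    show ?case
    proof (cases "p = q")
      case False
      define p' where "p' = (if i' < i then (i - 1, j) else (i, j - 1))"
      have p'q: "(p', q) \<in> cell_order"
        using le False by (auto simp: p'_def pq cell_order_def)
      have pp': "(p, p') \<in> cell_order" "fst p' + snd p' < fst p + snd p"
        using le False by (auto simp: p'_def pq cell_order_def)
      have p': "p' \<in> skew_cells lam mu"
        using order_convex_skew_cells[OF shape] less.prems(1) assms(3) pp'(1) p'q
        unfolding order_convex_def by blast
      have "(p, p') \<in> {((i + 1, j), (i, j)) | i j. True} \<union> {((i, j + 1), (i, j)) | i j. True}"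
        using le False by (auto simp: p'_def pq)
      then have "(p, p') \<in> skew_covers lam mu"
        using less.prems(1) p' by (simp add: skew_covers_def)
      then show ?thesis using less.hyps[OF pp'(2) p' p'q] by (rule converse_rtrancl_into_rtrancl)
    qed simp
  qed
  then show ?thesis using assms(5) by (simp add: skew_less_def rtrancl_eq_or_trancl)
qed

text \<open>On the shape \<open>cell_order\<close> is the reflexive closure of
  \<open>skew_less\<close>, and reflexive pairs impose no inequality.\<close>

lemma marked_order_polytope_cell_order:
  assumes "skew_shape lam mu"
  shows "marked_order_polytope (skew_cells lam mu) (skew_less lam mu) A l =
    marked_order_polytope (skew_cells lam mu) cell_order A l"
proof -
  have "(p, q) \<in> cell_order \<longleftrightarrow> p = q \<or> (p, q) \<in> skew_less lam mu"
    if "p \<in> skew_cells lam mu" "q \<in> skew_cells lam mu" for p q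
    using skew_lessD(1)[of p q] skew_lessI[OF assms that] by (auto simp: cell_order_def)
  then show ?thesis
    unfolding marked_order_polytope_def by (intro Collect_cong conj_cong refl ball_cong) auto
qed

text \<open>Going strictly down raises the coordinate sum, so a cell of largest sum among those
  below \<open>p\<close> is minimal.\<close>

lemma minimal_element_below:
  assumes shape: "skew_shape lam mu" and p: "p \<in> skew_cells lam mu"
  shows "\<exists>a\<in>minimal_elements (skew_cells lam mu) (skew_less lam mu). (a, p) \<in> cell_order"
proof -
  define S where "S = {q\<in>skew_cells lam mu. (q, p) \<in> cell_order}"
  have "finite S" unfolding S_def using finite_skew_cells[OF shape] by simp
  have "p \<in> S" using p by (simp add: S_def cell_order_def)
  have "Max ((\<lambda>q. fst q + snd q) ` S) \<in> (\<lambda>q. fst q + snd q) ` S"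
    using \<open>finite S\<close> \<open>p \<in> S\<close> by (intro Max_in) auto
  then obtain a where "a \<in> S" "Max ((\<lambda>q. fst q + snd q) ` S) = fst a + snd a" by blast
  moreover have "fst q + snd q \<le> Max ((\<lambda>q. fst q + snd q) ` S)" if "q \<in> S" for q
    using \<open>finite S\<close> that by (intro Max_ge) auto
  ultimately have a: "a \<in> S" "\<And>q. q \<in> S \<Longrightarrow> fst q + snd q \<le> fst a + snd a" by simp_all
  have False if "q \<in> skew_cells lam mu" "(q, a) \<in> skew_less lam mu" for q
  proof -
    have "q \<in> S"
      using that(1) a(1) skew_lessD(1)[OF that(2)] transD[OF trans_cell_order] unfolding S_def by blast
    then show False using a(2) skew_lessD(2)[OF that(2)] by fastforce
  qed
  then show ?thesis using a(1) unfolding S_def minimal_elements_def by blast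
qed

lemma maximal_element_above:
  assumes shape: "skew_shape lam mu" and p: "p \<in> skew_cells lam mu"
  shows "\<exists>a\<in>maximal_elements (skew_cells lam mu) (skew_less lam mu). (p, a) \<in> cell_order"
proof -
  define S where "S = {q\<in>skew_cells lam mu. (p, q) \<in> cell_order}"
  have "finite S" unfolding S_def using finite_skew_cells[OF shape] by simp
  have "p \<in> S" using p by (simp add: S_def cell_order_def)
  have "Min ((\<lambda>q. fst q + snd q) ` S) \<in> (\<lambda>q. fst q + snd q) ` S"
    using \<open>finite S\<close> \<open>p \<in> S\<close> by (intro Min_in) auto
  then obtain a where "a \<in> S" "Min ((\<lambda>q. fst q + snd q) ` S) = fst a + snd a" by blast
  moreover have "Min ((\<lambda>q. fst q + snd q) ` S) \<le> fst q + snd q" if "q \<in> S" for q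
    using \<open>finite S\<close> that by (intro Min_le) auto
  ultimately have a: "a \<in> S" "\<And>q. q \<in> S \<Longrightarrow> fst a + snd a \<le> fst q + snd q" by simp_all
  have False if "q \<in> skew_cells lam mu" "(a, q) \<in> skew_less lam mu" for q
  proof -
    have "q \<in> S"
      using that(1) a(1) skew_lessD(1)[OF that(2)] transD[OF trans_cell_order] unfolding S_def by blast
    then show False using a(2) skew_lessD(2)[OF that(2)] by fastforce
  qed
  then show ?thesis using a(1) unfolding S_def maximal_elements_def by blast
qed

theorem theorem1p5:
  fixes lam mu :: "nat \<Rightarrow> nat"
    and A :: "(nat \<times> nat) set"
    and l :: "nat \<times> nat \<Rightarrow> int"
  assumes "skew_shape lam mu"
    and "A \<subseteq> skew_cells lam mu"
    and "minimal_elements (skew_cells lam mu) (skew_less lam mu) \<subseteq> A"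
    and "maximal_elements (skew_cells lam mu) (skew_less lam mu) \<subseteq> A"
  shows "ehrhart_positive (skew_cells lam mu)
           (marked_order_polytope (skew_cells lam mu) (skew_less lam mu) A l)"
proof -
  let ?P = "skew_cells lam mu"
  have fin: "finite ?P" using finite_skew_cells[OF assms(1)] .
  \<comment> \<open>One choice of order polynomials for all finite convex subsets of the plane, as
    the induction in \<open>order_poly_nonneg_coeffs\<close> passes to subsets.\<close>
  obtain \<omega> :: "(nat \<times> nat) set \<Rightarrow> real poly" where
    \<omega>: "\<And>Q n. finite Q \<Longrightarrow> order_convex cell_order Q \<Longrightarrow>
      poly (\<omega> Q) (real n) = real (card (order_maps cell_order Q n))" and
    lin: "\<And>Q. finite Q \<Longrightarrow> order_convex cell_order Q \<Longrightarrow> 0 \<le> coeff (\<omega> Q) 1"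
    using order_polynomial_exists by metis
  have "ehrhart_positive ?P (marked_order_polytope ?P cell_order A l)"
  proof (rule ehrhart_positive_marked_order_polytope[OF fin trans_cell_order])
    show "\<exists>a\<in>A. (p, a) \<in> cell_order" if "p \<in> ?P" for p
      using maximal_element_above[OF assms(1) that] assms(4) by blast
    show "\<exists>a\<in>A. (a, p) \<in> cell_order" if "p \<in> ?P" for p
      using minimal_element_below[OF assms(1) that] assms(3) by blast
    fix Q assume Q: "Q \<subseteq> ?P" "order_convex cell_order Q"
    then have "finite Q" using fin by (auto intro: finite_subset)
    then show "poly (\<omega> Q) (real n) = real (card (order_maps cell_order Q n))" for n
      using \<omega> Q by blast
    show "nonneg_coeffs (\<omega> Q)"
      using \<open>finite Q\<close> Q(2) by (intro order_poly_nonneg_coeffs[of cell_order \<omega>, OF \<omega> lin])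
  qed (use assms(2) order_convex_skew_cells[OF assms(1)] in \<open>auto simp: cell_order_def\<close>)
  then show ?thesis by (simp add: marked_order_polytope_cell_order[OF assms(1)])
qed

end
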